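(* Let $P$ be a Cartan-Münzner polynomial homogeneous of degree $g\geq2$ and having multiplicities $m_1$ and $m_2$ on the $n$-dimensional Euclidean vector space $(V,h)$. Then the trace-free part $\omega_{i_1\dots i_g}$ of $P_{i_1\dots i_g}=D_{i_1}\dots D_{i_g}P$ satisfies $$\omega_{ip_1\dots p_{g-1}}\omega_j{}^{p_1\dots p_{g-1}}=b\,h_{ij}$$ for some constant $b\in\mathbb{R}$ (equivalently, $|D^{(g-1)}Q|^2=bE$, or $D_iD_j(|D^{(g-1)}Q|^2-bE)=0$, where $Q$ is the harmonic homogeneous degree $g$ polynomial with $D^{(g)}Q=\omega$), so the pair $(h,\omega)$ solves the coupled Einstein equations.
   Context: $h$ is a flat Riemannian (Euclidean) metric on the vector space $V$ with Levi-Civita connection $D$ and Laplacian $\Delta$; $D^{(j)}$ is the $j$-fold covariant derivative, $E(x)=|x|^2=h(x,x)$, and norms of tensors are defined by complete contraction with $h$. A Cartan-Münzner polynomial of degree $g$ with multiplicities $m_1,m_2$ is a polynomial $P:V\to\mathbb{R}$, homogeneous of degree $g$, satisfying $$|dP|^2=g^2E^{g-1},\qquad \Delta P=\tfrac{m_2-m_1}{2}g^2E^{\frac g2-1}.$$ (By Münzner, every isoparametric hypersurface in the unit sphere of $V$ with $g$ distinct principal curvatures having multiplicities $m_1,m_2$ arises as a level set of the restriction to the sphere of such a polynomial.) The trace-free part of a symmetric tensor is its $h$-orthogonal projection onto the completely trace-free symmetric tensors. For an $h$-trace-free completely symmetric $k$-tensor $\omega$, $k\geq2$, let $\rho(\omega)_{ij}=\omega_{ia_1\dots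 a_{k-1}}\omega_j{}^{a_1\dots a_{k-1}}$ and $|\omega|^2=\omega^{i_1\dots i_k}\omega_{i_1\dots i_k}$. The pair $(h,\omega)$ solves the coupled Einstein equations with constants $c,\kappa\in\mathbb{R}$ if $\omega$ is trace-free, divergence-free ($D^p\omega_{pi_1\dots i_{k-1}}=0$) and Codazzi ($D_i\omega_{ji_1\dots i_{k-1}}=D_j\omega_{ii_1\dots i_{k-1}}$), and $\mathrm{Ric}-\frac12\mathrm{scal}\,h+\frac{n-2}{2n}\kappa h=c\left(\rho(\omega)-\frac12|\omega|^2h\right)$, where $\mathrm{Ric}$ and $\mathrm{scal}$ are the Ricci and scalar curvatures of $h$ (here zero). That $(h,\omega)$ solves the coupled Einstein equations, with no constants specified, means here that for every $c\in\mathbb{R}$ there is $\kappa\in\mathbb{R}$ such that it solves them with constants $c,\kappa$.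
   Formalization: For g = 2 it is additionally assumed that m_1 = m_2 or |m_2 − m_1| = n; otherwise the claim is false, e.g. P = |x|^2 − |y|^2 on R^3 × R^2 with m_1 = 1, m_2 = 2. Nothing is added for g ≥ 3. *)

theory Defs
  imports "HOL-Analysis.Analysis"
begin

text \<open>
  The Euclidean vector space \<open>(V, h)\<close> is a type of class \<open>euclidean_space\<close> with \<open>h = (\<bullet>)\<close> and
  \<open>n = DIM('a)\<close>. A covariant \<open>k\<close>-tensor is its multilinear evaluation on lists of \<open>k\<close> vectors,
  extended by \<open>0\<close> to lists of any other length; with this convention equality of tensors is equality
  of functions. Since \<open>Basis\<close> is orthonormal, contraction with \<open>h\<close> is summation over \<open>Basis\<close>.
\<close>

type_synonym 'a tensor = "'a list \<Rightarrow> real"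

type_synonym 'a tensor_field = "'a \<Rightarrow> 'a tensor"

definition tensors :: "nat \<Rightarrow> 'a::euclidean_space tensor set" where
  "tensors k = {T.
     (\<forall>us vs. length us + length vs + 1 = k \<longrightarrow> linear (\<lambda>v. T (us @ v # vs))) \<and>
     (\<forall>vs. length vs \<noteq> k \<longrightarrow> T vs = 0)}"

definition sym_tensors :: "nat \<Rightarrow> 'a::euclidean_space tensor set" where
  "sym_tensors k = {T \<in> tensors k. \<forall>us vs. mset us = mset vs \<longrightarrow> T us = T vs}"

text \<open>By symmetry, the trace in the first two slots determines the trace in any two slots.\<close>

definition trace_free_tensors :: "nat \<Rightarrow> 'a::euclidean_space tensor set" where
  "trace_free_tensors k = {T \<in> sym_tensors k. \<forall>vs. (\<Sum>e\<in>Basis. T (e # e # vs)) = 0}"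

definition basis_lists :: "nat \<Rightarrow> 'a::euclidean_space list set" where
  "basis_lists k = {es. set es \<subseteq> Basis \<and> length es = k}"

definition tensor_inner :: "nat \<Rightarrow> 'a::euclidean_space tensor \<Rightarrow> 'a tensor \<Rightarrow> real" where
  "tensor_inner k S T = (\<Sum>es\<in>basis_lists k. S es * T es)"

abbreviation tensor_norm2 :: "nat \<Rightarrow> 'a::euclidean_space tensor \<Rightarrow> real" where
  "tensor_norm2 k T \<equiv> tensor_inner k T T"

definition trace_free_part :: "nat \<Rightarrow> 'a::euclidean_space tensor \<Rightarrow> 'a tensor" where
  "trace_free_part k T = (THE W. W \<in> trace_free_tensors k \<and>
     (\<forall>S\<in>trace_free_tensors k. tensor_inner k (\<lambda>vs. T vs - W vs) S = 0))"

text \<open>\<open>rho k \<omega> u v = \<omega>(u, a\<^sub>1, \<dots>) \<omega>(v, a\<^sub>1, \<dots>)\<close>, contracted over the last \<open>k - 1\<close> slots.\<close>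

definition rho :: "nat \<Rightarrow> 'a::euclidean_space tensor \<Rightarrow> 'a \<Rightarrow> 'a \<Rightarrow> real" where
  "rho k T u v = (\<Sum>es\<in>basis_lists (k - 1). T (u # es) * T (v # es))"

text \<open>
  The Levi-Civita connection of the flat metric differentiates components with respect to constant
  vectors. The new differentiation slot is the first one: \<open>(D T)(v, vs) = D\<^sub>v T (vs)\<close>.
\<close>

definition cov_deriv :: "'a::euclidean_space tensor_field \<Rightarrow> 'a tensor_field" where
  "cov_deriv T x vs =
     (case vs of [] \<Rightarrow> 0 | v # ws \<Rightarrow> frechet_derivative (\<lambda>y. T y ws) (at x) v)"

definition scalar_field :: "('a::euclidean_space \<Rightarrow> real) \<Rightarrow> 'a tensor_field" where
  "scalar_field f x vs = (if vs = [] then f x else 0)"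

definition iter_deriv :: "nat \<Rightarrow> ('a::euclidean_space \<Rightarrow> real) \<Rightarrow> 'a tensor_field" where
  "iter_deriv k f = (cov_deriv ^^ k) (scalar_field f)"

definition laplacian :: "('a::euclidean_space \<Rightarrow> real) \<Rightarrow> 'a \<Rightarrow> real" where
  "laplacian f x = (\<Sum>e\<in>Basis. iter_deriv 2 f x [e, e])"

definition quad_E :: "'a::euclidean_space \<Rightarrow> real" where
  "quad_E x = x \<bullet> x"

text \<open>The zero polynomial is homogeneous of every degree.\<close>

definition homogeneous_polynomial :: "nat \<Rightarrow> ('a::euclidean_space \<Rightarrow> real) \<Rightarrow> bool" where
  "homogeneous_polynomial g P \<longleftrightarrow>
     real_polynomial_function P \<and> (\<forall>t x. P (t *\<^sub>R x) = t ^ g * P x)"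

text \<open>
  \<open>E\<^bsup>g/2-1\<^esup>\<close> is written as \<open>(sqrt E) powi (g - 2)\<close>. Using \<open>E powr (g / 2 - 1)\<close> would be wrong at the
  origin for \<open>g = 2\<close>, since \<open>0 powr 0 = 0\<close>.
\<close>

definition cartan_muenzner :: "nat \<Rightarrow> nat \<Rightarrow> nat \<Rightarrow> ('a::euclidean_space \<Rightarrow> real) \<Rightarrow> bool" where
  "cartan_muenzner g m1 m2 P \<longleftrightarrow>
     homogeneous_polynomial g P \<and>
     (\<forall>x. tensor_norm2 1 (iter_deriv 1 P x) = (real g)\<^sup>2 * quad_E x ^ (g - 1)) \<and>
     (\<forall>x. laplacian P x =
        (real m2 - real m1) / 2 * (real g)\<^sup>2 * sqrt (quad_E x) powi (int g - 2))"

text \<open>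
  Curvature of the flat connection, with
  \<open>R(X,Y)Z = D\<^sub>X D\<^sub>Y Z - D\<^sub>Y D\<^sub>X Z - D\<^bsub>[X,Y]\<^esub> Z\<close>. Being tensorial, it may be
  evaluated on constant extensions of vectors, as is done for the Ricci curvature.
\<close>

definition conn :: "('a::euclidean_space \<Rightarrow> 'a) \<Rightarrow> ('a \<Rightarrow> 'a) \<Rightarrow> 'a \<Rightarrow> 'a" where
  "conn X Y x = frechet_derivative Y (at x) (X x)"

definition lie_bracket :: "('a::euclidean_space \<Rightarrow> 'a) \<Rightarrow> ('a \<Rightarrow> 'a) \<Rightarrow> 'a \<Rightarrow> 'a" where
  "lie_bracket X Y x = frechet_derivative Y (at x) (X x) - frechet_derivative X (at x) (Y x)"

definition curvature ::
  "('a::euclidean_space \<Rightarrow> 'a) \<Rightarrow> ('a \<Rightarrow> 'a) \<Rightarrow> ('a \<Rightarrow> 'a) \<Rightarrow> 'a \<Rightarrow> 'a" where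
  "curvature X Y Z x =
     conn X (conn Y Z) x - conn Y (conn X Z) x - conn (lie_bracket X Y) Z x"

definition ricci :: "'a::euclidean_space \<Rightarrow> 'a \<Rightarrow> 'a \<Rightarrow> real" where
  "ricci x u v = (\<Sum>e\<in>Basis. curvature (\<lambda>_. e) (\<lambda>_. u) (\<lambda>_. v) x \<bullet> e)"

definition scal :: "'a::euclidean_space \<Rightarrow> real" where
  "scal x = (\<Sum>e\<in>Basis. ricci x e e)"

definition smooth_tensor_field :: "'a::euclidean_space tensor_field \<Rightarrow> bool" where
  "smooth_tensor_field T \<longleftrightarrow>
     (\<forall>m vs x. (\<lambda>y. (cov_deriv ^^ m) T y vs) differentiable (at x))"

definition coupled_einstein ::
  "nat \<Rightarrow> real \<Rightarrow> real \<Rightarrow> 'a::euclidean_space tensor_field \<Rightarrow> bool" where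
  "coupled_einstein k c \<kappa> \<omega> \<longleftrightarrow>
     2 \<le> k \<and>
     smooth_tensor_field \<omega> \<and>
     (\<forall>x. \<omega> x \<in> trace_free_tensors k) \<and>
     (\<forall>x vs. length vs = k - 1 \<longrightarrow> (\<Sum>e\<in>Basis. cov_deriv \<omega> x (e # e # vs)) = 0) \<and>
     (\<forall>x u v vs. length vs = k - 1 \<longrightarrow>
        cov_deriv \<omega> x (u # v # vs) = cov_deriv \<omega> x (v # u # vs)) \<and>
     (\<forall>x u v.
        ricci x u v - 1 / 2 * scal x * (u \<bullet> v)
          + (real DIM('a) - 2) / (2 * real DIM('a)) * \<kappa> * (u \<bullet> v)
        = c * (rho k (\<omega> x) u v - 1 / 2 * tensor_norm2 k (\<omega> x) * (u \<bullet> v)))"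

end

theory Submission
  imports Defs
begin

text \<open>
  The trace-free part of \<open>D\<^sup>g P\<close> is the top derivative of a harmonic polynomial. Since \<open>\<Delta>P\<close> is a
  multiple of a power of \<open>E\<close>, there is a decomposition \<open>P = Q + a E\<^bsup>g/2\<^esup>\<close> with \<open>Q\<close> harmonic and
  homogeneous of degree \<open>g\<close>; for odd \<open>g\<close> parity forces \<open>a = 0\<close>
  (\<open>cartan_muenzner_harmonic_part\<close>). A trace-free constant-coefficient operator of order \<open>g\<close>
  annihilates \<open>E\<^bsup>g/2\<^esup>\<close> (\<open>contracted_deriv_quad_E_power\<close>), so the trace-free part \<open>\<omega>\<close> of \<open>D\<^sup>g P\<close> is
  \<open>D\<^sup>g Q\<close> (\<open>trace_free_part_iter_deriv\<close>).

  Euler's relation turns the gradient equation for \<open>P\<close> into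
    \<open>|dQ|\<^sup>2 = g\<^sup>2 ((1 - a\<^sup>2) E\<^bsup>g-1\<^esup> - 2 a E\<^bsup>g/2-1\<^esup> Q)\<close>
  (\<open>deriv_norm2_harmonic_part\<close>). Now apply \<open>\<Delta>\<^bsup>g-2\<^esup>\<close>. For harmonic \<open>Q\<close> the flat Bochner identity
  \<open>\<Delta>|D\<^sup>k Q|\<^sup>2 = 2 |D\<^bsup>k+1\<^esup> Q|\<^sup>2\<close> (\<open>lap_deriv_norm2\<close>) makes the left-hand side a positive multiple of
  \<open>|D\<^bsup>g-1\<^esup> Q|\<^sup>2\<close>. On the right, each Laplacian lowers the exponent of \<open>E\<close> by one
  (\<open>lap_mult_quad_E_power\<close>), so the first term becomes a multiple of \<open>E\<close>, and the second one vanishes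
  when \<open>g/2 - 1 < g - 2\<close>, that is when \<open>g > 2\<close>. For \<open>g = 2\<close> the second term survives
  unless \<open>a = 0\<close>; the hypothesis on the multiplicities says that either \<open>a = 0\<close> or \<open>a\<^sup>2 = 1\<close>, and in the
  latter case \<open>|dQ|\<^sup>2\<close> is a multiple of \<open>Q\<close>, hence harmonic, which forces \<open>D\<^sup>2 Q = 0\<close>. In all
  cases \<open>|D\<^bsup>g-1\<^esup> Q|\<^sup>2 = b E\<close> (\<open>deriv_norm2_eq_quad_E\<close>).

  Finally \<open>\<omega>\<close> is a constant tensor and \<open>|D\<^bsup>g-1\<^esup> Q|\<^sup>2\<close> at \<open>x\<close> is \<open>\<rho>(\<omega>)(x, x)\<close>
  (\<open>rho_iter_deriv_diag\<close>), so polarisation gives \<open>\<rho>(\<omega>) = b h\<close>. For a constant tensor on flat space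
  the coupled Einstein equations reduce to this algebraic identity (\<open>coupled_einstein_constant\<close>).
\<close>

section \<open>Directional derivatives of polynomial functions\<close>

definition dirderiv :: "'a::euclidean_space \<Rightarrow> ('a \<Rightarrow> real) \<Rightarrow> 'a \<Rightarrow> real" where
  "dirderiv v f x = frechet_derivative f (at x) v"

text \<open>The head of the list is differentiated last, as in \<^const>\<open>cov_deriv\<close>.\<close>

fun dirderivs :: "'a::euclidean_space list \<Rightarrow> ('a \<Rightarrow> real) \<Rightarrow> 'a \<Rightarrow> real" where
  "dirderivs [] f = f"
| "dirderivs (v # vs) f = dirderiv v (dirderivs vs f)"

definition lap :: "('a::euclidean_space \<Rightarrow> real) \<Rightarrow> 'a \<Rightarrow> real" where
  "lap f x = (\<Sum>e\<in>Basis. dirderiv e (dirderiv e f) x)"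

text \<open>
  Euler's relation \<open>x\<^sup>i D\<^sub>i f = d f\<close> stands in for homogeneity of degree \<open>d\<close>. It is
  a pointwise linear equation, so it passes to derivatives by differentiating it, with no
  special treatment of the origin. The degree is a real number so that it may
  drop by one under differentiation without a side condition.
\<close>

definition euler_homogeneous :: "real \<Rightarrow> ('a::euclidean_space \<Rightarrow> real) \<Rightarrow> bool" where
  "euler_homogeneous d f \<longleftrightarrow> (\<forall>x. dirderiv x f x = d * f x)"

lemma dirderiv_eqI: "(f has_derivative f') (at x) \<Longrightarrow> dirderiv v f x = f' v"
  unfolding dirderiv_def by (metis frechet_derivative_at)

text \<open>
  Everything below happens among polynomial functions. This closure property makes them a
  class on which the Frechet derivative may be iterated freely and obeys all product and sum
  rules without differentiability side conditions.
\<close>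

lemma poly_has_poly_derivative:
  fixes f :: "'a::euclidean_space \<Rightarrow> real"
  assumes "real_polynomial_function f"
  shows "\<exists>f'. (\<forall>x. (f has_derivative f' x) (at x)) \<and> (\<forall>v. real_polynomial_function (\<lambda>x. f' x v))"
  using assms
proof induction
  case (linear f)
  then show ?case
    by (intro exI[of _ "\<lambda>x. f"]) (auto intro: bounded_linear_imp_has_derivative)
next
  case (const c)
  show ?case by (intro exI[of _ "\<lambda>x v. 0"]) (auto intro: real_polynomial_function.intros)
next
  case (add f g)
  then obtain f' g' where
    "\<forall>x. (f has_derivative f' x) (at x)" "\<forall>v. real_polynomial_function (\<lambda>x. f' x v)"
    "\<forall>x. (g has_derivative g' x) (at x)" "\<forall>v. real_polynomial_function (\<lambda>x. g' x v)"
    by blast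
  then show ?case
    by (intro exI[of _ "\<lambda>x v. f' x v + g' x v"])
      (auto intro: real_polynomial_function.intros derivative_intros)
next
  case (mult f g)
  then obtain f' g' where
    *: "\<And>x. (f has_derivative f' x) (at x)" "\<And>v. real_polynomial_function (\<lambda>x. f' x v)"
    "\<And>x. (g has_derivative g' x) (at x)" "\<And>v. real_polynomial_function (\<lambda>x. g' x v)"
    by blast
  show ?case
    by (intro exI[of _ "\<lambda>x v. f x * g' x v + f' x v * g x"] conjI allI)
      (rule has_derivative_mult * real_polynomial_function.intros(3,4) mult.hyps)+
qed

lemma has_dirderiv:
  fixes f :: "'a::euclidean_space \<Rightarrow> real"
  assumes "real_polynomial_function f"
  shows "(f has_derivative (\<lambda>v. dirderiv v f x)) (at x)"
proof -
  obtain f' where f': "(f has_derivative f' x) (at x)"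
    using poly_has_poly_derivative[OF assms] by blast
  then have "f' x = (\<lambda>v. dirderiv v f x)"
    by (simp add: dirderiv_eqI[OF f'])
  with f' show ?thesis by simp
qed

lemma poly_dirderiv:
  assumes "real_polynomial_function f"
  shows "real_polynomial_function (dirderiv v f)"
proof -
  obtain f' where "\<forall>x. (f has_derivative f' x) (at x)"
    and p: "\<forall>v. real_polynomial_function (\<lambda>x. f' x v)"
    using poly_has_poly_derivative[OF assms] by blast
  then have "dirderiv v f = (\<lambda>x. f' x v)"
    using dirderiv_eqI by blast
  with p show ?thesis by simp
qed

lemma poly_dirderivs:
  "real_polynomial_function f \<Longrightarrow> real_polynomial_function (dirderivs vs f)"
  by (induction vs) (auto intro: poly_dirderiv)

lemma poly_inner_left: "real_polynomial_function (\<lambda>x::'a::euclidean_space. x \<bullet> v)"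
  by (intro real_polynomial_function.intros(1) bounded_linear_inner_left)

lemma poly_quad_E: "real_polynomial_function (quad_E :: 'a::euclidean_space \<Rightarrow> real)"
proof -
  have "real_polynomial_function (\<lambda>x::'a. \<Sum>e\<in>Basis. (x \<bullet> e) * (x \<bullet> e))"
    by (intro real_polynomial_function_sum real_polynomial_function.intros(4) poly_inner_left) simp
  moreover have "(\<lambda>x::'a. \<Sum>e\<in>Basis. (x \<bullet> e) * (x \<bullet> e)) = quad_E"
    by (auto simp: quad_E_def fun_eq_iff intro: euclidean_inner[symmetric])
  ultimately show ?thesis by simp
qed

named_theorems poly_rules
lemmas [poly_rules] = real_polynomial_function.intros(2-4)
  real_polynomial_function_diff
  real_polynomial_function_power real_polynomial_function_sum finite_Basis
  poly_dirderiv poly_dirderivs poly_inner_left poly_quad_E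

lemma poly_lap [poly_rules]:
  "real_polynomial_function f \<Longrightarrow> real_polynomial_function (lap f)"
  unfolding lap_def[abs_def] by (intro poly_rules)

lemma dirderiv_const [simp]: "dirderiv v (\<lambda>x. c) = (\<lambda>x. 0)"
  by (rule ext, rule dirderiv_eqI) (rule has_derivative_const)

lemma dirderiv_add:
  "real_polynomial_function f \<Longrightarrow> real_polynomial_function g \<Longrightarrow>
   dirderiv v (\<lambda>x. f x + g x) = (\<lambda>x. dirderiv v f x + dirderiv v g x)"
  by (rule ext, rule dirderiv_eqI) (intro has_derivative_add has_dirderiv)

lemma dirderiv_mult:
  "real_polynomial_function f \<Longrightarrow> real_polynomial_function g \<Longrightarrow>
   dirderiv v (\<lambda>x. f x * g x) = (\<lambda>x. f x * dirderiv v g x + dirderiv v f x * g x)"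
  by (rule ext, rule dirderiv_eqI) (intro has_derivative_mult has_dirderiv)

lemma dirderiv_cmult:
  "real_polynomial_function f \<Longrightarrow> dirderiv v (\<lambda>x. c * f x) = (\<lambda>x. c * dirderiv v f x)"
  by (simp add: dirderiv_mult poly_rules)

lemma dirderiv_diff:
  "real_polynomial_function f \<Longrightarrow> real_polynomial_function g \<Longrightarrow>
   dirderiv v (\<lambda>x. f x - g x) = (\<lambda>x. dirderiv v f x - dirderiv v g x)"
  by (rule ext, rule dirderiv_eqI) (intro has_derivative_diff has_dirderiv)

lemma dirderiv_sum:
  "finite I \<Longrightarrow> (\<And>i. i \<in> I \<Longrightarrow> real_polynomial_function (f i)) \<Longrightarrow>
   dirderiv v (\<lambda>x. \<Sum>i\<in>I. f i x) = (\<lambda>x. \<Sum>i\<in>I. dirderiv v (f i) x)"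
  by (rule ext, rule dirderiv_eqI) (intro has_derivative_sum has_dirderiv)

lemma dirderiv_inner [simp]: "dirderiv v (\<lambda>x. x \<bullet> w) = (\<lambda>x. v \<bullet> w)"
  by (rule ext, rule dirderiv_eqI) (auto intro!: derivative_eq_intros)

lemma dirderiv_quad_E: "dirderiv v quad_E = (\<lambda>x. 2 * (x \<bullet> v))"
  unfolding quad_E_def[abs_def]
  by (rule ext, rule dirderiv_eqI) (auto intro!: derivative_eq_intros simp: inner_commute)

lemma linear_dirderiv:
  "real_polynomial_function f \<Longrightarrow> linear (\<lambda>v. dirderiv v f x)"
  using has_derivative_linear[OF has_dirderiv] .

lemma dirderiv_basis:
  fixes f :: "'a::euclidean_space \<Rightarrow> real"
  assumes "real_polynomial_function f"
  shows "dirderiv v f x = (\<Sum>e\<in>Basis. (v \<bullet> e) * dirderiv e f x)"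
proof -
  have "dirderiv v f x = dirderiv (\<Sum>e\<in>Basis. (v \<bullet> e) *\<^sub>R e) f x"
    by (simp add: euclidean_representation)
  also have "\<dots> = (\<Sum>e\<in>Basis. (v \<bullet> e) * dirderiv e f x)"
    by (subst linear_sum[OF linear_dirderiv[OF assms]])
      (simp add: linear_scale[OF linear_dirderiv[OF assms]])
  finally show ?thesis .
qed

text \<open>
  Among polynomials the symmetry of second derivatives is an induction over the way the
  polynomial is built; the product case is the Leibniz rule applied twice.
\<close>

lemma dirderiv_commute:
  "real_polynomial_function f \<Longrightarrow> dirderiv u (dirderiv v f) = dirderiv v (dirderiv u f)"
proof (induction rule: real_polynomial_function.induct)
  case (linear f)
  have "dirderiv w f = (\<lambda>x. f w)" for w
    by (rule ext, rule dirderiv_eqI) (rule bounded_linear_imp_has_derivative[OF linear])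
  then show ?case by simp
next
  case (const c)
  show ?case by simp
next
  case (add f g)
  then show ?case by (simp add: dirderiv_add poly_rules)
next
  case (mult f g)
  then show ?case by (simp add: dirderiv_add dirderiv_mult poly_rules) (simp add: algebra_simps)
qed

lemma dirderivs_commute:
  "real_polynomial_function f \<Longrightarrow> dirderivs vs (dirderiv v f) = dirderiv v (dirderivs vs f)"
  by (induction vs) (auto simp: dirderiv_commute poly_rules)

lemma dirderivs_append: "dirderivs (us @ vs) f = dirderivs us (dirderivs vs f)"
  by (induction us) auto

lemma dirderivs_add:
  "real_polynomial_function f \<Longrightarrow> real_polynomial_function g \<Longrightarrow>
   dirderivs vs (\<lambda>x. f x + g x) = (\<lambda>x. dirderivs vs f x + dirderivs vs g x)"
  by (induction vs) (auto simp: dirderiv_add poly_rules)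

lemma dirderivs_cmult:
  "real_polynomial_function f \<Longrightarrow> dirderivs vs (\<lambda>x. c * f x) = (\<lambda>x. c * dirderivs vs f x)"
  by (induction vs) (auto simp: dirderiv_cmult poly_rules)

lemma dirderivs_zero [simp]: "dirderivs vs (\<lambda>x. 0) = (\<lambda>x. 0)"
  by (induction vs) auto

lemma dirderivs_sum:
  "finite I \<Longrightarrow> (\<And>i. i \<in> I \<Longrightarrow> real_polynomial_function (f i)) \<Longrightarrow>
   dirderivs vs (\<lambda>x. \<Sum>i\<in>I. f i x) = (\<lambda>x. \<Sum>i\<in>I. dirderivs vs (f i) x)"
  by (induction vs) (auto simp: dirderiv_sum poly_rules)

lemma dirderivs_remove1:
  "real_polynomial_function f \<Longrightarrow> v \<in> set vs \<Longrightarrow>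
   dirderivs vs f = dirderiv v (dirderivs (remove1 v vs) f)"
  by (induction vs) (auto simp: dirderiv_commute poly_rules)

lemma dirderivs_mset:
  assumes "real_polynomial_function f" "mset us = mset vs"
  shows "dirderivs us f = dirderivs vs f"
  using assms(2)
proof (induction us arbitrary: vs)
  case (Cons u us)
  then have "u \<in> set vs" by (metis list.set_intros(1) mset_eq_setD)
  moreover have "mset us = mset (remove1 u vs)" using Cons.prems by (metis mset_remove1 remove1.simps(2))
  ultimately show ?case
    using Cons.IH[of "remove1 u vs"] dirderivs_remove1[OF assms(1), of u vs] by simp
qed simp

text \<open>An inner direction can be moved to the front, where the outermost derivative is linear in it.\<close>

lemma linear_dirderivs:
  assumes "real_polynomial_function f"
  shows "linear (\<lambda>v. dirderivs (us @ v # vs) f x)"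
proof -
  have "(\<lambda>v. dirderivs (us @ v # vs) f x) = (\<lambda>v. dirderiv v (dirderivs us (dirderivs vs f)) x)"
    using assms by (simp add: dirderivs_append dirderivs_commute poly_rules)
  then show ?thesis using assms by (simp add: linear_dirderiv poly_rules)
qed

section \<open>Iterated covariant derivatives in components\<close>

text \<open>
  This translates iterated covariant derivatives into iterated directional derivatives: wrong
  lengths are annihilated because differentiating the constant \<open>0\<close> gives \<open>0\<close>.
\<close>

lemma iter_deriv_eq:
  "iter_deriv k f x vs = (if length vs = k then dirderivs vs f x else 0)"
proof (induction k arbitrary: x vs)
  case 0
  show ?case by (auto simp: iter_deriv_def scalar_field_def)
next
  case (Suc k)
  have rec: "iter_deriv (Suc k) f = cov_deriv (iter_deriv k f)"
    by (simp add: iter_deriv_def)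
  show ?case
  proof (cases vs)
    case Nil
    then show ?thesis by (simp add: rec cov_deriv_def)
  next
    case (Cons v ws)
    show ?thesis
    proof (cases "length ws = k")
      case True
      then show ?thesis by (simp add: rec cov_deriv_def Cons Suc dirderiv_def)
    next
      case False
      then show ?thesis by (simp add: rec cov_deriv_def Cons Suc)
    qed
  qed
qed

lemma laplacian_eq: "laplacian f = lap f"
  by (simp add: fun_eq_iff laplacian_def lap_def iter_deriv_eq)

lemma basis_lists_Suc:
  "basis_lists (Suc k) = (\<lambda>(e, es). e # es) ` (Basis \<times> basis_lists k)"
  by (force simp: basis_lists_def length_Suc_conv)

lemma basis_lists_0: "basis_lists 0 = {[]}"
  by (auto simp: basis_lists_def)

lemma finite_basis_lists [simp]: "finite (basis_lists k)"
  by (induction k) (auto simp: basis_lists_0 basis_lists_Suc)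

lemma sum_basis_lists_Suc:
  "(\<Sum>es\<in>basis_lists (Suc k). F es) = (\<Sum>e\<in>Basis. \<Sum>es\<in>basis_lists k. F (e # es))"
  unfolding basis_lists_Suc
  by (subst sum.reindex) (auto simp: inj_on_def sum.cartesian_product intro: sum.cong)

lemma length_basis_lists: "es \<in> basis_lists k \<Longrightarrow> length es = k"
  by (simp add: basis_lists_def)

definition deriv_norm2 :: "nat \<Rightarrow> ('a::euclidean_space \<Rightarrow> real) \<Rightarrow> 'a \<Rightarrow> real" where
  "deriv_norm2 k f x = (\<Sum>es\<in>basis_lists k. (dirderivs es f x)\<^sup>2)"

lemma tensor_norm2_iter_deriv: "tensor_norm2 k (iter_deriv k f x) = deriv_norm2 k f x"
  by (auto simp: tensor_inner_def iter_deriv_eq deriv_norm2_def power2_eq_square length_basis_lists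
      intro!: sum.cong)

lemma poly_deriv_norm2 [poly_rules]:
  "real_polynomial_function f \<Longrightarrow> real_polynomial_function (deriv_norm2 k f)"
  unfolding deriv_norm2_def[abs_def] by (intro poly_rules) simp_all

section \<open>The Bochner identity for harmonic polynomials\<close>

lemma dirderivs_lap:
  "real_polynomial_function f \<Longrightarrow> dirderivs vs (lap f) = lap (dirderivs vs f)"
  by (simp add: lap_def[abs_def] dirderivs_sum dirderivs_commute poly_rules)

lemma lap_diff:
  "real_polynomial_function f \<Longrightarrow> real_polynomial_function g \<Longrightarrow>
   lap (\<lambda>x. f x - g x) = (\<lambda>x. lap f x - lap g x)"
  by (simp add: lap_def[abs_def] dirderiv_diff poly_rules sum_subtractf)

lemma lap_cmult:
  "real_polynomial_function f \<Longrightarrow> lap (\<lambda>x. c * f x) = (\<lambda>x. c * lap f x)"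
  by (simp add: lap_def[abs_def] dirderiv_cmult poly_rules sum_distrib_left)

lemma lap_const [simp]: "lap (\<lambda>x. c) = (\<lambda>x. 0)"
  by (simp add: lap_def[abs_def])

lemma lap_sum:
  "finite I \<Longrightarrow> (\<And>i. i \<in> I \<Longrightarrow> real_polynomial_function (f i)) \<Longrightarrow>
   lap (\<lambda>x. \<Sum>i\<in>I. f i x) = (\<lambda>x. \<Sum>i\<in>I. lap (f i) x)"
  by (simp add: lap_def[abs_def] dirderiv_sum poly_rules) (auto intro: sum.swap)

text \<open>
  The Bochner identity for functions. In flat space \<open>\<Delta>(f\<^sup>2) = 2 |df|\<^sup>2 + 2 f \<Delta>f\<close>, and there is no
  curvature term.
\<close>

lemma lap_square:
  assumes "real_polynomial_function f" "lap f = (\<lambda>x. 0)"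
  shows "lap (\<lambda>x. (f x)\<^sup>2) = (\<lambda>x. 2 * (\<Sum>e\<in>Basis. (dirderiv e f x)\<^sup>2))"
proof
  fix x
  have "lap (\<lambda>x. (f x)\<^sup>2) x = 2 * (\<Sum>e\<in>Basis. (dirderiv e f x)\<^sup>2) + 2 * f x * lap f x"
    using assms(1)
    by (simp add: lap_def power2_eq_square dirderiv_add dirderiv_mult poly_rules sum.distrib
        sum_distrib_left algebra_simps)
  then show "lap (\<lambda>x. (f x)\<^sup>2) x = 2 * (\<Sum>e\<in>Basis. (dirderiv e f x)\<^sup>2)"
    by (simp add: assms(2))
qed

text \<open>
  Every component of \<open>D\<^sup>k f\<close> is again harmonic, so the previous identity applies to each summand
  of \<open>|D\<^sup>k f|\<^sup>2\<close>. This lets iterated Laplacians of \<open>|df|\<^sup>2\<close> climb to \<open>|D\<^sup>k f|\<^sup>2\<close>.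
\<close>

lemma lap_deriv_norm2:
  assumes "real_polynomial_function f" "lap f = (\<lambda>x. 0)"
  shows "lap (deriv_norm2 k f) = (\<lambda>x. 2 * deriv_norm2 (Suc k) f x)"
proof -
  have "lap (dirderivs es f) = (\<lambda>x. 0)" for es
    using assms by (simp flip: dirderivs_lap)
  then have sq: "lap (\<lambda>x. (dirderivs es f x)\<^sup>2) =
      (\<lambda>x. 2 * (\<Sum>e\<in>Basis. (dirderiv e (dirderivs es f) x)\<^sup>2))" for es
    using assms(1) by (intro lap_square poly_rules)
  have "lap (deriv_norm2 k f) = (\<lambda>x. \<Sum>es\<in>basis_lists k. lap (\<lambda>x. (dirderivs es f x)\<^sup>2) x)"
    unfolding deriv_norm2_def[abs_def] by (intro lap_sum poly_rules assms(1)) simp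
  also have "\<dots> = (\<lambda>x. 2 * deriv_norm2 (Suc k) f x)"
    by (simp add: sq deriv_norm2_def sum_basis_lists_Suc sum_distrib_left sum.swap[of _ _ Basis])
  finally show ?thesis .
qed

lemma lap_funpow_deriv_norm2:
  assumes "real_polynomial_function f" "lap f = (\<lambda>x. 0)"
  shows "(lap ^^ j) (deriv_norm2 1 f) = (\<lambda>x. 2 ^ j * deriv_norm2 (Suc j) f x)"
  by (induction j) (use assms in \<open>simp_all add: lap_cmult lap_deriv_norm2 poly_rules mult_ac\<close>)

lemma poly_lap_funpow [poly_rules]:
  "real_polynomial_function f \<Longrightarrow> real_polynomial_function ((lap ^^ j) f)"
  by (induction j) (auto intro: poly_rules)

lemma lap_funpow_diff:
  "real_polynomial_function f \<Longrightarrow> real_polynomial_function g \<Longrightarrow>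
   (lap ^^ j) (\<lambda>x. f x - g x) = (\<lambda>x. (lap ^^ j) f x - (lap ^^ j) g x)"
  by (induction j) (simp_all add: lap_diff poly_rules)

lemma lap_funpow_cmult:
  "real_polynomial_function f \<Longrightarrow> (lap ^^ j) (\<lambda>x. c * f x) = (\<lambda>x. c * (lap ^^ j) f x)"
  by (induction j) (simp_all add: lap_cmult poly_rules)

section \<open>Euler's relation and multiples of powers of the quadratic form\<close>

text \<open>Differentiate \<open>x\<^sup>i D\<^sub>i f = d f\<close> in direction \<open>v\<close>: the factor \<open>x\<^sup>i\<close> contributes one extra \<open>D\<^sub>v f\<close>.\<close>

lemma euler_dirderiv:
  assumes "real_polynomial_function f" "euler_homogeneous d f"
  shows "euler_homogeneous (d - 1) (dirderiv v f)"
proof -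
  have eq: "(\<lambda>x. \<Sum>e\<in>Basis. (x \<bullet> e) * dirderiv e f x) = (\<lambda>x. d * f x)"
    using assms by (simp add: euler_homogeneous_def fun_eq_iff flip: dirderiv_basis)
  have "dirderiv v (\<lambda>x. \<Sum>e\<in>Basis. (x \<bullet> e) * dirderiv e f x) =
      (\<lambda>x. (\<Sum>e\<in>Basis. (x \<bullet> e) * dirderiv e (dirderiv v f) x) + (\<Sum>e\<in>Basis. (v \<bullet> e) * dirderiv e f x))"
    using assms(1) by (simp add: dirderiv_sum dirderiv_mult poly_rules sum.distrib
        dirderiv_commute[of f v])
  then have "(\<lambda>x. dirderiv x (dirderiv v f) x + dirderiv v f x) = (\<lambda>x. d * dirderiv v f x)"
    unfolding eq using assms(1) by (simp add: dirderiv_cmult poly_rules flip: dirderiv_basis)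
  then show ?thesis
    by (simp add: euler_homogeneous_def fun_eq_iff algebra_simps)
qed

lemma euler_dirderivs:
  "real_polynomial_function f \<Longrightarrow> euler_homogeneous d f \<Longrightarrow> euler_homogeneous (d - real (length vs)) (dirderivs vs f)"
proof (induction vs)
  case (Cons v vs)
  then show ?case
    using euler_dirderiv[of "dirderivs vs f" "d - real (length vs)" v]
    by (simp add: poly_rules algebra_simps)
qed simp

text \<open>
  Iterating Euler's relation along the radial direction recovers a homogeneous polynomial from
  its top derivative: \<open>D\<^sup>d f(x, \<dots>, x) = d! f(x)\<close> is the case \<open>j = d\<close>.
\<close>

lemma euler_replicate:
  assumes "real_polynomial_function f" "euler_homogeneous (real d) f" "j \<le> d"
  shows "dirderivs (replicate j x) f x * fact (d - j) = fact d * f x"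
  using assms(3)
proof (induction j)
  case (Suc j)
  have "dirderivs (replicate (Suc j) x) f x = (real d - real j) * dirderivs (replicate j x) f x"
    using euler_dirderivs[OF assms(1,2), of "replicate j x"] by (simp add: euler_homogeneous_def)
  moreover have "fact (d - j) = (real d - real j) * fact (d - Suc j)"
    using Suc.prems by (metis Suc_diff_Suc Suc_le_lessD fact_Suc of_nat_diff Suc_leD of_nat_mult)
  ultimately show ?case using Suc by (simp add: mult_ac)
qed simp

lemma euler_mult_quad_E:
  assumes "real_polynomial_function f" "euler_homogeneous d f"
  shows "euler_homogeneous (d + 2) (\<lambda>x. quad_E x * f x)"
  using assms unfolding euler_homogeneous_def
  by (simp add: dirderiv_mult dirderiv_quad_E poly_rules) (simp add: quad_E_def algebra_simps)

text \<open>The cross term \<open>2 \<langle>dE, df\<rangle> = 4 x\<^sup>i D\<^sub>i f\<close> of the Leibniz rule is a multiple of \<open>f\<close> by Euler's relation.\<close>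

lemma lap_mult_quad_E:
  fixes f :: "'a::euclidean_space \<Rightarrow> real"
  assumes "real_polynomial_function f" "euler_homogeneous d f"
  shows "lap (\<lambda>x. quad_E x * f x) = (\<lambda>x. (2 * real DIM('a) + 4 * d) * f x + quad_E x * lap f x)"
proof
  fix x :: 'a
  have "lap (\<lambda>x. quad_E x * f x) x =
      2 * real DIM('a) * f x + 4 * (\<Sum>e\<in>Basis. (x \<bullet> e) * dirderiv e f x) + quad_E x * lap f x"
    using assms(1)
    by (simp add: lap_def dirderiv_mult dirderiv_add dirderiv_quad_E dirderiv_cmult poly_rules
        sum.distrib sum_distrib_left algebra_simps inner_Basis)
  also have "(\<Sum>e\<in>Basis. (x \<bullet> e) * dirderiv e f x) = d * f x"
    using assms by (simp add: euler_homogeneous_def flip: dirderiv_basis)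
  finally show "lap (\<lambda>x. quad_E x * f x) x =
      (2 * real DIM('a) + 4 * d) * f x + quad_E x * lap f x"
    by (simp add: algebra_simps)
qed

lemma euler_mult_quad_E_power:
  assumes "real_polynomial_function f" "euler_homogeneous d f"
  shows "euler_homogeneous (d + 2 * real k) (\<lambda>x. quad_E x ^ k * f x)"
proof (induction k)
  case 0
  then show ?case using assms by simp
next
  case (Suc k)
  have "euler_homogeneous (d + 2 * real k + 2) (\<lambda>x. quad_E x * (quad_E x ^ k * f x))"
    by (intro euler_mult_quad_E Suc poly_rules assms(1))
  then show ?case by (simp add: algebra_simps)
qed

text \<open>
  On \<open>E\<^sup>k f\<close> with \<open>f\<close> harmonic the Laplacian only lowers the exponent of \<open>E\<close>. Hence iterated
  Laplacians keep \<open>f\<close> until the powers of \<open>E\<close> are used up, and then give \<open>0\<close>.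
\<close>

lemma lap_mult_quad_E_power:
  fixes f :: "'a::euclidean_space \<Rightarrow> real"
  assumes "real_polynomial_function f" "euler_homogeneous d f" "lap f = (\<lambda>x. 0)"
  shows "lap (\<lambda>x. quad_E x ^ Suc k * f x) =
    (\<lambda>x. 2 * (real k + 1) * (real DIM('a) + 2 * real k + 2 * d) * (quad_E x ^ k * f x))"
proof (induction k)
  case 0
  then show ?case
    using lap_mult_quad_E[OF assms(1,2)] by (simp add: assms(3) algebra_simps)
next
  case (Suc k)
  have "lap (\<lambda>x. quad_E x * (quad_E x ^ Suc k * f x)) =
    (\<lambda>x. (2 * real DIM('a) + 4 * (d + 2 * real (Suc k))) * (quad_E x ^ Suc k * f x)
      + quad_E x * lap (\<lambda>x. quad_E x ^ Suc k * f x) x)"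
    by (intro lap_mult_quad_E euler_mult_quad_E_power assms(1,2) poly_rules)
  then show ?case unfolding Suc by (simp add: algebra_simps)
qed

lemma lap_funpow_mult_quad_E_power:
  assumes "real_polynomial_function f" "euler_homogeneous d f" "lap f = (\<lambda>x. 0)"
  shows "\<exists>C. (lap ^^ j) (\<lambda>x. quad_E x ^ (j + m) * f x) = (\<lambda>x. C * (quad_E x ^ m * f x))"
proof (induction j)
  case 0
  show ?case by (intro exI[of _ 1]) simp
next
  case (Suc j)
  have poly: "real_polynomial_function (\<lambda>x. quad_E x ^ k * f x)" for k
    by (intro poly_rules assms(1))
  obtain C where C: "(lap ^^ j) (\<lambda>x. quad_E x ^ (j + m) * f x) = (\<lambda>x. C * (quad_E x ^ m * f x))"
    using Suc by blast
  define c where "c = 2 * (real (j + m) + 1) * (real DIM('a) + 2 * real (j + m) + 2 * d)"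
  have "lap (\<lambda>x. quad_E x ^ (Suc j + m) * f x) = (\<lambda>x. c * (quad_E x ^ (j + m) * f x))"
    using lap_mult_quad_E_power[OF assms, of "j + m"] by (simp add: c_def)
  then have "(lap ^^ Suc j) (\<lambda>x. quad_E x ^ (Suc j + m) * f x) =
      (\<lambda>x. (c * C) * (quad_E x ^ m * f x))"
    unfolding funpow_Suc_right o_apply
    by (simp add: lap_funpow_cmult poly C mult.assoc)
  then show ?case by blast
qed

lemma lap_funpow_zero [simp]: "(lap ^^ j) (\<lambda>x. 0) = (\<lambda>x. 0)"
  by (induction j) auto

lemma lap_funpow_mult_quad_E_power_zero:
  assumes "real_polynomial_function f" "euler_homogeneous d f" "lap f = (\<lambda>x. 0)" "m < j"
  shows "(lap ^^ j) (\<lambda>x. quad_E x ^ m * f x) = (\<lambda>x. 0)"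
proof -
  obtain i where j: "j = i + Suc m" using assms(4) less_imp_add_positive by (metis add.commute add_Suc_right less_iff_Suc_add)
  obtain C where "(lap ^^ m) (\<lambda>x. quad_E x ^ m * f x) = (\<lambda>x. C * f x)"
    using lap_funpow_mult_quad_E_power[OF assms(1-3), of m 0] by auto
  then show ?thesis
    unfolding j funpow_add funpow.simps(2) o_apply using assms(1,3) by (simp add: lap_cmult)
qed

lemma dirderiv_quad_E_power:
  "dirderiv v (\<lambda>x. quad_E x ^ Suc k) = (\<lambda>x. 2 * real (Suc k) * (x \<bullet> v) * quad_E x ^ k)"
proof (induction k)
  case 0
  show ?case by (simp add: dirderiv_quad_E)
next
  case (Suc k)
  have "dirderiv v (\<lambda>x. quad_E x * quad_E x ^ Suc k) =
     (\<lambda>x. quad_E x * dirderiv v (\<lambda>x. quad_E x ^ Suc k) x + dirderiv v quad_E x * quad_E x ^ Suc k)"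
    by (intro dirderiv_mult poly_rules)
  then show ?case unfolding Suc by (simp add: dirderiv_quad_E algebra_simps)
qed

lemma dirderivs_const: "vs \<noteq> [] \<Longrightarrow> dirderivs vs (\<lambda>x. c) = (\<lambda>x. 0)"
proof (induction vs)
  case (Cons v vs) then show ?case by (cases vs) auto
qed simp

section \<open>Trace-free tensors annihilate derivatives of powers of the quadratic form\<close>

text \<open>
  Symmetry and vanishing traces without multilinearity. Only the values on basis lists enter
  the contractions below, and inserting a vector in the first slot preserves both properties.
\<close>

definition sym_trace_free :: "'a::euclidean_space tensor \<Rightarrow> bool" where
  "sym_trace_free S \<longleftrightarrow> (\<forall>us vs. mset us = mset vs \<longrightarrow> S us = S vs) \<and>
     (\<forall>vs. (\<Sum>e\<in>Basis. S (e # e # vs)) = 0)"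

lemma sym_trace_free_Cons:
  assumes "sym_trace_free S"
  shows "sym_trace_free (\<lambda>vs. S (v # vs))"
  unfolding sym_trace_free_def
proof (intro conjI allI impI)
  have sym: "S us = S vs" if "mset us = mset vs" for us vs
    using assms that unfolding sym_trace_free_def by blast
  show "S (v # us) = S (v # vs)" if "mset us = mset vs" for us vs
    by (rule sym) (simp add: that)
  fix vs
  have "S (v # e # e # vs) = S (e # e # v # vs)" for e
    by (rule sym) (simp add: add_mset_commute)
  moreover have "(\<Sum>e\<in>Basis. S (e # e # v # vs)) = 0"
    using assms unfolding sym_trace_free_def by blast
  ultimately show "(\<Sum>e\<in>Basis. S (v # e # e # vs)) = 0"
    by (simp only:)
qed

text \<open>The constant-coefficient differential operator \<open>S(D) = S(i\<^sub>1, \<dots>, i\<^sub>k) D\<^sub>i\<^sub>1 \<dots> D\<^sub>i\<^sub>k\<close> with symbol \<open>S\<close>.\<close>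

definition contracted_deriv :: "nat \<Rightarrow> 'a::euclidean_space tensor \<Rightarrow> ('a \<Rightarrow> real) \<Rightarrow> 'a \<Rightarrow> real" where
  "contracted_deriv k S f x = (\<Sum>es\<in>basis_lists k. S es * dirderivs es f x)"

lemma contracted_deriv_Suc:
  "real_polynomial_function f \<Longrightarrow>
   contracted_deriv (Suc k) S f = (\<lambda>x. \<Sum>e\<in>Basis. dirderiv e (contracted_deriv k (\<lambda>vs. S (e # vs)) f) x)"
  unfolding contracted_deriv_def[abs_def]
  by (subst dirderiv_sum) (auto simp: sum_basis_lists_Suc dirderiv_cmult poly_rules)

lemma poly_contracted_deriv [poly_rules]:
  "real_polynomial_function f \<Longrightarrow> real_polynomial_function (contracted_deriv k S f)"
  unfolding contracted_deriv_def[abs_def] by (intro poly_rules) auto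

lemma contracted_deriv_sum:
  "contracted_deriv k (\<lambda>vs. \<Sum>i\<in>I. T i vs) f x = (\<Sum>i\<in>I. contracted_deriv k (T i) f x)"
  unfolding contracted_deriv_def sum_distrib_right by (rule sum.swap)

text \<open>
  For a trace-free symbol, differentiating \<open>E f\<close> loses a term: in the Leibniz expansion no
  derivative, one derivative or two derivatives hit \<open>E\<close>, and the last kind contracts
  two slots of \<open>S\<close> with \<open>D\<^sup>2 E = 2 h\<close>, which is a trace.
\<close>

lemma contracted_deriv_mult_quad_E:
  fixes f :: "'a::euclidean_space \<Rightarrow> real"
  assumes "real_polynomial_function f" "sym_trace_free S"
  shows "contracted_deriv (Suc k) S (\<lambda>x. quad_E x * f x) =
    (\<lambda>x. quad_E x * contracted_deriv (Suc k) S f x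
      + 2 * real (Suc k) * (\<Sum>i\<in>Basis. (x \<bullet> i) * contracted_deriv k (\<lambda>vs. S (i # vs)) f x))"
  using assms(2)
proof (induction k arbitrary: S)
  case 0
  show ?case
    using assms(1)
    by (simp add: contracted_deriv_def[abs_def] sum_basis_lists_Suc basis_lists_0
        dirderiv_mult dirderiv_quad_E poly_rules sum.distrib sum_distrib_left algebra_simps)
next
  case (Suc k)
  let ?S1 = "\<lambda>e vs. S (e # vs)" and ?S2 = "\<lambda>e i vs. S (e # i # vs)"
  have sym: "S (e # i # vs) = S (i # e # vs)" for e i vs
    using Suc.prems unfolding sym_trace_free_def by (auto simp: add_mset_commute)
  have comm: "contracted_deriv k (?S2 e i) f = contracted_deriv k (?S2 i e) f" for e i
    by (simp only: sym[of e i])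
  have trace: "(\<Sum>e\<in>Basis. contracted_deriv k (?S2 e e) f x) = 0" for x
  proof -
    have "(\<lambda>vs. \<Sum>e\<in>Basis. ?S2 e e vs) = (\<lambda>vs. 0)"
      using Suc.prems unfolding sym_trace_free_def by blast
    then show ?thesis
      by (simp flip: contracted_deriv_sum) (simp add: contracted_deriv_def)
  qed
  have deriv: "dirderiv e (contracted_deriv (Suc k) (?S1 e) (\<lambda>x. quad_E x * f x)) x =
      quad_E x * dirderiv e (contracted_deriv (Suc k) (?S1 e) f) x
      + 2 * (x \<bullet> e) * contracted_deriv (Suc k) (?S1 e) f x
      + 2 * real (Suc k) * ((\<Sum>i\<in>Basis. (x \<bullet> i) * dirderiv e (contracted_deriv k (?S2 e i) f) x)
          + contracted_deriv k (?S2 e e) f x)"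
    if e: "e \<in> Basis" for e x
    using assms(1) e unfolding Suc.IH[OF sym_trace_free_Cons[OF Suc.prems]]
    by (simp add: dirderiv_add dirderiv_mult dirderiv_sum dirderiv_quad_E poly_rules sum.distrib
        inner_Basis if_distrib[of "\<lambda>c. c * _"] cong: if_cong)
  \<comment> \<open>The remaining derivative recombines with \<open>S(i, e, \<dots>)\<close> to \<open>S(i, \<dots>)(D)\<close>.\<close>
  have swap: "(\<Sum>e\<in>Basis. \<Sum>i\<in>Basis. (x \<bullet> i) * dirderiv e (contracted_deriv k (?S2 e i) f) x) =
      (\<Sum>i\<in>Basis. (x \<bullet> i) * contracted_deriv (Suc k) (?S1 i) f x)" for x
  proof -
    have "(\<Sum>e\<in>Basis. (x \<bullet> i) * dirderiv e (contracted_deriv k (?S2 e i) f) x) =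
        (x \<bullet> i) * contracted_deriv (Suc k) (?S1 i) f x" for i
      by (simp add: contracted_deriv_Suc[OF assms(1)] sum_distrib_left comm[of _ i])
    then show ?thesis by (subst sum.swap) simp
  qed
  show ?case
  proof
    fix x
    have "contracted_deriv (Suc (Suc k)) S (\<lambda>x. quad_E x * f x) x =
      (\<Sum>e\<in>Basis. dirderiv e (contracted_deriv (Suc k) (?S1 e) (\<lambda>x. quad_E x * f x)) x)"
      by (subst contracted_deriv_Suc) (intro poly_rules assms(1) refl)+
    also have "\<dots> = quad_E x * contracted_deriv (Suc (Suc k)) S f x
      + 2 * (\<Sum>e\<in>Basis. (x \<bullet> e) * contracted_deriv (Suc k) (?S1 e) f x)
      + 2 * real (Suc k) * (\<Sum>e\<in>Basis. \<Sum>i\<in>Basis. (x \<bullet> i) * dirderiv e (contracted_deriv k (?S2 e i) f) x)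
      + 2 * real (Suc k) * (\<Sum>e\<in>Basis. contracted_deriv k (?S2 e e) f x)"
      by (simp add: deriv contracted_deriv_Suc[OF assms(1), of "Suc k" S] sum.distrib distrib_left
          mult.assoc flip: sum_distrib_left)
    also have "\<dots> = quad_E x * contracted_deriv (Suc (Suc k)) S f x
      + 2 * real (Suc (Suc k)) * (\<Sum>i\<in>Basis. (x \<bullet> i) * contracted_deriv (Suc k) (?S1 i) f x)"
      unfolding swap trace by (simp add: algebra_simps)
    finally show "contracted_deriv (Suc (Suc k)) S (\<lambda>x. quad_E x * f x) x = \<dots>" .
  qed
qed

text \<open>
  Each factor \<open>E\<close> is either left undifferentiated or uses up a single slot of \<open>S\<close>, terms
  with two derivatives on the same factor being traces. After \<open>m\<close>
  factors at least \<open>k - m > 0\<close> derivatives remain, and they act on a constant. For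
  \<open>k = 2 m\<close> this says that \<open>D\<^sup>k(E\<^sup>m)\<close> is orthogonal to the trace-free tensors.
\<close>

lemma contracted_deriv_quad_E_power:
  fixes S :: "'a::euclidean_space tensor"
  assumes "sym_trace_free S" "m < k"
  shows "contracted_deriv k S (\<lambda>x. quad_E x ^ m) = (\<lambda>x. 0)"
  using assms
proof (induction m arbitrary: k S)
  case 0
  have "dirderivs es (\<lambda>x::'a. 1) = (\<lambda>x. 0)" if "es \<in> basis_lists k" for es
    using that 0 by (intro dirderivs_const) (auto dest: length_basis_lists)
  then show ?case by (simp add: contracted_deriv_def[abs_def])
next
  case (Suc m)
  then obtain j where k: "k = Suc j" "m < j" by (metis Suc_lessE)
  then show ?case
    using Suc.prems
    by (simp add: contracted_deriv_mult_quad_E Suc.IH sym_trace_free_Cons poly_rules)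
qed

section \<open>The trace-free part\<close>

text \<open>Multilinear expansion, replacing the arguments by basis vectors from left to right.\<close>

lemma tensors_eq_0:
  assumes "T \<in> tensors k" "\<And>es. es \<in> basis_lists k \<Longrightarrow> T es = 0"
  shows "T vs = 0"
proof -
  have "T (us @ vs) = 0" if "length us + length vs = k" "set us \<subseteq> Basis" for us
    using that
  proof (induction vs arbitrary: us)
    case Nil
    then show ?case using assms(2) by (simp add: basis_lists_def)
  next
    case (Cons v vs)
    have lin: "linear (\<lambda>v. T (us @ v # vs))"
      using assms(1) Cons.prems by (simp add: tensors_def)
    have "T (us @ e # vs) = 0" if "e \<in> Basis" for e
      using Cons.IH[of "us @ [e]"] Cons.prems that by simp
    then have "(\<Sum>e\<in>Basis. (v \<bullet> e) * T (us @ e # vs)) = 0" by simp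
    moreover have "T (us @ v # vs) = T (us @ (\<Sum>e\<in>Basis. (v \<bullet> e) *\<^sub>R e) # vs)"
      by (simp add: euclidean_representation)
    ultimately show ?case
      by (simp add: linear_sum[OF lin] linear_scale[OF lin])
  qed
  from this[of "[]"] show ?thesis
    using assms(1) by (cases "length vs = k") (auto simp: tensors_def)
qed

lemma trace_free_tensors_diff:
  "S \<in> trace_free_tensors k \<Longrightarrow> T \<in> trace_free_tensors k \<Longrightarrow>
   (\<lambda>vs. S vs - T vs) \<in> trace_free_tensors k"
  unfolding trace_free_tensors_def sym_tensors_def tensors_def mem_Collect_eq
proof (elim conjE, intro conjI allI impI)
  fix us vs :: "'a list"
  assume lin: "\<forall>us vs. length us + length vs + 1 = k \<longrightarrow> linear (\<lambda>v. S (us @ v # vs))"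
    "\<forall>us vs. length us + length vs + 1 = k \<longrightarrow> linear (\<lambda>v. T (us @ v # vs))"
    and len: "length us + length vs + 1 = k"
  show "linear (\<lambda>v. S (us @ v # vs) - T (us @ v # vs))"
    by (rule linear_compose_sub[OF lin[rule_format, OF len]])
next
  fix us vs :: "'a list"
  assume sym: "\<forall>us vs. mset us = mset vs \<longrightarrow> S us = S vs" "\<forall>us vs. mset us = mset vs \<longrightarrow> T us = T vs"
    and eq: "mset us = mset vs"
  show "S us - T us = S vs - T vs"
    by (simp only: sym[rule_format, OF eq])
next
  fix vs :: "'a list"
  assume "\<forall>vs. length vs \<noteq> k \<longrightarrow> S vs = 0" "\<forall>vs. length vs \<noteq> k \<longrightarrow> T vs = 0" "length vs \<noteq> k"
  then show "S vs - T vs = 0" by simp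
next
  fix vs :: "'a list"
  assume tr: "\<forall>vs. (\<Sum>e\<in>Basis. S (e # e # vs)) = 0" "\<forall>vs. (\<Sum>e\<in>Basis. T (e # e # vs)) = 0"
  show "(\<Sum>e\<in>Basis. S (e # e # vs) - T (e # e # vs)) = 0"
    by (simp add: sum_subtractf tr)
qed

text \<open>
  Uniqueness of the orthogonal projection: the difference of two candidates is itself trace-free
  and hence orthogonal to itself.
\<close>

lemma trace_free_part_eqI:
  assumes W: "W \<in> trace_free_tensors k"
    and orth: "\<And>S. S \<in> trace_free_tensors k \<Longrightarrow> tensor_inner k (\<lambda>vs. T vs - W vs) S = 0"
  shows "trace_free_part k T = W"
  unfolding trace_free_part_def
proof (rule the_equality)
  show "W \<in> trace_free_tensors k \<and>
     (\<forall>S\<in>trace_free_tensors k. tensor_inner k (\<lambda>vs. T vs - W vs) S = 0)"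
    using assms by blast
next
  fix W'
  assume W': "W' \<in> trace_free_tensors k \<and>
     (\<forall>S\<in>trace_free_tensors k. tensor_inner k (\<lambda>vs. T vs - W' vs) S = 0)"
  define Z where "Z = (\<lambda>vs. W' vs - W vs)"
  have Z: "Z \<in> trace_free_tensors k"
    using W W' by (simp add: Z_def trace_free_tensors_diff)
  have "tensor_inner k Z Z = tensor_inner k (\<lambda>vs. T vs - W vs) Z - tensor_inner k (\<lambda>vs. T vs - W' vs) Z"
    by (simp add: tensor_inner_def Z_def algebra_simps flip: sum_subtractf)
  then have "(\<Sum>es\<in>basis_lists k. (Z es)\<^sup>2) = 0"
    using Z W' orth by (simp add: tensor_inner_def power2_eq_square)
  then have "\<And>es. es \<in> basis_lists k \<Longrightarrow> Z es = 0"
    by (simp add: sum_nonneg_eq_0_iff)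
  moreover have "Z \<in> tensors k"
    using Z unfolding trace_free_tensors_def sym_tensors_def by blast
  ultimately have "Z vs = 0" for vs
    using tensors_eq_0 by blast
  then show "W' = W" by (simp add: Z_def fun_eq_iff)
qed

lemma trace_free_tensors_sym_trace_free: "S \<in> trace_free_tensors k \<Longrightarrow> sym_trace_free S"
  unfolding trace_free_tensors_def sym_tensors_def sym_trace_free_def by blast

text \<open>Contracting two slots of \<open>D\<^sup>k f\<close> gives \<open>D\<^bsup>k-2\<^esup>(\<Delta>f)\<close>.\<close>

lemma iter_deriv_trace_free:
  assumes "real_polynomial_function f" "lap f = (\<lambda>x. 0)"
  shows "iter_deriv k f x \<in> trace_free_tensors k"
  unfolding trace_free_tensors_def sym_tensors_def tensors_def
proof (intro CollectI conjI allI impI)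
  show "linear (\<lambda>v. iter_deriv k f x (us @ v # vs))" if "length us + length vs + 1 = k" for us vs
    using that assms(1) by (auto simp: iter_deriv_eq linear_dirderivs)
  show "iter_deriv k f x vs = 0" if "length vs \<noteq> k" for vs
    using that by (simp add: iter_deriv_eq)
  show "iter_deriv k f x us = iter_deriv k f x vs" if "mset us = mset vs" for us vs
    using dirderivs_mset[OF assms(1) that] mset_eq_length[OF that] by (simp add: iter_deriv_eq)
  fix vs
  have "(\<Sum>e\<in>Basis. dirderiv e (dirderiv e (dirderivs vs f)) x) = 0"
    using assms by (simp flip: lap_def dirderivs_lap)
  then show "(\<Sum>e\<in>Basis. iter_deriv k f x (e # e # vs)) = 0"
    by (cases "length vs + 2 = k") (simp_all add: iter_deriv_eq)
qed

text \<open>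
  The trace-free part of \<open>D\<^sup>k P\<close> comes from the harmonic part of \<open>P\<close>: the other summand is a
  multiple of a power of \<open>E\<close>, whose derivative is orthogonal to all trace-free tensors.
\<close>

lemma trace_free_part_iter_deriv:
  assumes "real_polynomial_function Q" "lap Q = (\<lambda>x. 0)"
    and "a = 0 \<or> m < k"
    and "P = (\<lambda>x. Q x + a * quad_E x ^ m)"
  shows "trace_free_part k (iter_deriv k P x) = iter_deriv k Q x"
proof (rule trace_free_part_eqI[OF iter_deriv_trace_free[OF assms(1,2)]])
  fix S :: "'a tensor" assume "S \<in> trace_free_tensors k"
  then have S: "sym_trace_free S" by (rule trace_free_tensors_sym_trace_free)
  have "tensor_inner k (\<lambda>vs. iter_deriv k P x vs - iter_deriv k Q x vs) S =
      (\<Sum>es\<in>basis_lists k. a * (S es * dirderivs es (\<lambda>x. quad_E x ^ m) x))"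
    unfolding tensor_inner_def
  proof (rule sum.cong[OF refl])
    fix es :: "'a list" assume "es \<in> basis_lists k"
    then show "(iter_deriv k P x es - iter_deriv k Q x es) * S es =
        a * (S es * dirderivs es (\<lambda>x. quad_E x ^ m) x)"
      using assms(1) by (simp add: assms(4) iter_deriv_eq length_basis_lists dirderivs_add
          dirderivs_cmult poly_rules)
  qed
  also have "\<dots> = a * contracted_deriv k S (\<lambda>x. quad_E x ^ m) x"
    by (simp add: contracted_deriv_def sum_distrib_left)
  also have "\<dots> = 0"
    using assms(3) S by (auto simp: contracted_deriv_quad_E_power)
  finally show "tensor_inner k (\<lambda>vs. iter_deriv k P x vs - iter_deriv k Q x vs) S = 0" .
qed

section \<open>Homogeneous polynomials\<close>

text \<open>Differentiate \<open>P(t x) = t\<^sup>g P(x)\<close> at \<open>t = 1\<close>.\<close>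

lemma homogeneous_polynomial_euler:
  fixes P :: "'a::euclidean_space \<Rightarrow> real"
  assumes "homogeneous_polynomial g P"
  shows "euler_homogeneous (real g) P"
  unfolding euler_homogeneous_def
proof
  fix x :: 'a
  have poly: "real_polynomial_function P" and hom: "\<And>t. P (t *\<^sub>R x) = t ^ g * P x"
    using assms by (auto simp: homogeneous_polynomial_def)
  have "((\<lambda>t. P (t *\<^sub>R x)) has_derivative (\<lambda>h. dirderiv (h *\<^sub>R x) P (1 *\<^sub>R x))) (at 1)"
    by (rule has_derivative_compose[of "\<lambda>t. t *\<^sub>R x" "\<lambda>h. h *\<^sub>R x", OF _ has_dirderiv[OF poly]])
      (auto intro!: derivative_eq_intros)
  moreover have "((\<lambda>t. t ^ g * P x) has_derivative (\<lambda>h. h * (real g * P x))) (at 1)"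
    by (auto intro!: derivative_eq_intros)
  ultimately have "(\<lambda>h. dirderiv (h *\<^sub>R x) P (1 *\<^sub>R x)) = (\<lambda>h. h * (real g * P x))"
    unfolding hom by (rule has_derivative_unique)
  from fun_cong[OF this, of 1] show "dirderiv x P x = real g * P x" by simp
qed

text \<open>
  The derivative along a ray from the origin vanishes away from the origin; continuity at
  the origin then joins all rays.
\<close>

lemma euler_0_constant:
  fixes f :: "'a::euclidean_space \<Rightarrow> real"
  assumes poly: "real_polynomial_function f" and "euler_homogeneous 0 f"
  shows "f x = f 0"
proof -
  have der: "((\<lambda>t. f (t *\<^sub>R x)) has_derivative (\<lambda>h. dirderiv (h *\<^sub>R x) f (t *\<^sub>R x))) (at t)" for t
    by (rule has_derivative_compose[of "\<lambda>t. t *\<^sub>R x" "\<lambda>h. h *\<^sub>R x", OF _ has_dirderiv[OF poly]])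
      (auto intro!: derivative_eq_intros)
  have "DERIV (\<lambda>t. f (t *\<^sub>R x)) t :> 0" if "0 < t" for t
  proof -
    have scale: "dirderiv (c *\<^sub>R v) f y = c * dirderiv v f y" for c v y
      using linear_scale[OF linear_dirderiv[OF poly]] by simp
    have "t * dirderiv x f (t *\<^sub>R x) = 0"
      using assms(2) by (simp add: euler_homogeneous_def flip: scale)
    with that have "(\<lambda>h. dirderiv (h *\<^sub>R x) f (t *\<^sub>R x)) = (*) 0"
      by (simp add: scale fun_eq_iff)
    with der[of t] show ?thesis by (simp add: has_field_derivative_def)
  qed
  moreover have "continuous_on {0..1} (\<lambda>t. f (t *\<^sub>R x))"
    using der by (meson continuous_at_imp_continuous_on has_derivative_continuous)
  ultimately have "f (1 *\<^sub>R x) = f (0 *\<^sub>R x)"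
    by (intro DERIV_isconst_end) auto
  then show ?thesis by simp
qed

lemma iter_deriv_constant:
  assumes "homogeneous_polynomial g Q"
  shows "iter_deriv g Q x = iter_deriv g Q 0"
proof
  fix vs
  have poly: "real_polynomial_function Q"
    using assms by (simp add: homogeneous_polynomial_def)
  show "iter_deriv g Q x vs = iter_deriv g Q 0 vs"
  proof (cases "length vs = g")
    case True
    then have "euler_homogeneous 0 (dirderivs vs Q)"
      using euler_dirderivs[OF poly homogeneous_polynomial_euler[OF assms], of vs] by simp
    from euler_0_constant[OF poly_dirderivs[OF poly] this] show ?thesis
      by (simp add: iter_deriv_eq True)
  qed (simp add: iter_deriv_eq)
qed

lemma iter_deriv_determines:
  fixes Q R :: "'a::euclidean_space \<Rightarrow> real"
  assumes "homogeneous_polynomial g Q" "homogeneous_polynomial g R"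
    and "iter_deriv g Q = iter_deriv g R"
  shows "Q = R"
proof
  fix x :: 'a
  have "dirderivs (replicate g x) F x = fact g * F x" if "homogeneous_polynomial g F" for F
    using euler_replicate[OF _ homogeneous_polynomial_euler[OF that], of g x] that
    by (simp add: homogeneous_polynomial_def)
  moreover have "dirderivs (replicate g x) Q x = dirderivs (replicate g x) R x"
    using fun_cong[OF fun_cong[OF assms(3), of x], of "replicate g x"] by (simp add: iter_deriv_eq)
  ultimately show "Q x = R x" using assms(1,2) by simp
qed

section \<open>The harmonic part of a Cartan-Muenzner polynomial\<close>

lemma dirderiv_reflect:
  fixes f :: "'a::euclidean_space \<Rightarrow> real"
  assumes poly: "real_polynomial_function f" and parity: "\<And>x. f (- x) = s * f x"
  shows "dirderiv v f (- x) = - s * dirderiv v f x"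
proof -
  have "((\<lambda>x. f (- x)) has_derivative (\<lambda>h. dirderiv (- h) f (- x))) (at x)"
    by (rule has_derivative_compose[of uminus uminus, OF _ has_dirderiv[OF poly]])
      (auto intro!: derivative_eq_intros)
  moreover have "((\<lambda>x. s * f x) has_derivative (\<lambda>h. s * dirderiv h f x)) (at x)"
    by (intro has_derivative_mult_right has_dirderiv poly)
  ultimately have "(\<lambda>h. dirderiv (- h) f (- x)) = (\<lambda>h. s * dirderiv h f x)"
    unfolding parity by (rule has_derivative_unique)
  from fun_cong[OF this, of v] show ?thesis
    by (simp add: linear_neg[OF linear_dirderiv[OF poly]])
qed

lemma lap_reflect:
  fixes f :: "'a::euclidean_space \<Rightarrow> real"
  assumes poly: "real_polynomial_function f" and parity: "\<And>x. f (- x) = s * f x"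
  shows "lap f (- x) = s * lap f x"
proof -
  have "dirderiv v f (- x) = - s * dirderiv v f x" for v x
    by (rule dirderiv_reflect[OF assms])
  from dirderiv_reflect[OF poly_dirderiv[OF poly] this]
  show ?thesis by (simp add: lap_def sum_distrib_left)
qed

lemma cartan_muenzner_lap:
  fixes P :: "'a::euclidean_space \<Rightarrow> real"
  assumes "cartan_muenzner g m1 m2 P"
  shows "lap P x = (real m2 - real m1) / 2 * (real g)\<^sup>2 * sqrt (quad_E x) powi (int g - 2)"
  using assms by (simp add: cartan_muenzner_def laplacian_eq)

text \<open>
  For odd \<open>g\<close> the Laplacian of \<open>P\<close> is an odd function, but it is prescribed to be a multiple of an
  even one, so \<open>P\<close> is already harmonic. For \<open>g = 2 (k + 1)\<close> the Laplacian is a multiple of \<open>E\<^sup>k\<close>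
  and is cancelled by the Laplacian of a multiple of \<open>E\<^bsup>k+1\<^esup>\<close>. The value of \<open>a\<close> is recorded because
  for \<open>g = 2\<close> it decides whether the result holds; for odd \<open>g\<close> the exponent \<open>k\<close> is arbitrary.
\<close>

lemma cartan_muenzner_harmonic_part:
  fixes P :: "'a::euclidean_space \<Rightarrow> real"
  assumes "g \<ge> 2" and cm: "cartan_muenzner g m1 m2 P"
  obtains Q a k where "homogeneous_polynomial g Q" "lap Q = (\<lambda>x. 0)"
    "P = (\<lambda>x. Q x + a * quad_E x ^ Suc k)"
    "a = 0 \<or> g = 2 * Suc k \<and> a * (real DIM('a) + 2 * real k) = (real m2 - real m1) * real (Suc k)"
proof (cases "even g")
  case False
  have hom: "homogeneous_polynomial g P" using cm by (simp add: cartan_muenzner_def)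
  have "lap P x = 0" for x
  proof -
    have "P (- y) = (- 1) * P y" for y
    proof -
      have "P (- 1 *\<^sub>R y) = (- 1) ^ g * P y"
        using hom unfolding homogeneous_polynomial_def by blast
      with False show ?thesis by simp
    qed
    then have "lap P (- x) = (- 1) * lap P x"
      using hom by (intro lap_reflect) (auto simp: homogeneous_polynomial_def)
    moreover have "lap P (- x) = lap P x"
      by (simp add: cartan_muenzner_lap[OF cm] quad_E_def)
    ultimately show ?thesis by simp
  qed
  then have "lap P = (\<lambda>x. 0)" by blast
  then show thesis by (intro that[of P 0 0] hom) auto
next
  case True
  have hom: "homogeneous_polynomial g P" using cm by (simp add: cartan_muenzner_def)
  then have poly: "real_polynomial_function P" by (simp add: homogeneous_polynomial_def)
  obtain k where g: "g = 2 * Suc k"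
    using True assms(1) by (metis Suc_le_D dvdE mult_0_right not_numeral_le_zero old.nat.exhaust)
  define d where "d = real DIM('a) + 2 * real k"
  define a where "a = (real m2 - real m1) * real (Suc k) / d"
  have d: "d > 0" by (simp add: d_def add_pos_nonneg)
  have a: "a * d = (real m2 - real m1) * real (Suc k)" using d by (simp add: a_def)
  have E: "real_polynomial_function (\<lambda>x::'a. a * quad_E x ^ Suc k)"
    by (intro poly_rules)
  define Q where "Q = (\<lambda>x. P x - a * quad_E x ^ Suc k)"
  have "lap P x = lap (\<lambda>x. a * quad_E x ^ Suc k) x" for x
  proof -
    have "sqrt (quad_E x) powi (int g - 2) = sqrt (quad_E x) powi int (2 * k)"
      by (simp add: g)
    also have "\<dots> = quad_E x ^ k"
      by (simp only: power_int_of_nat power_mult) (simp add: quad_E_def)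
    finally have "lap P x = (real m2 - real m1) * real (Suc k) * (2 * (real k + 1)) * quad_E x ^ k"
      by (simp add: cartan_muenzner_lap[OF cm] g power2_eq_square field_simps)
    moreover have "lap (\<lambda>x. quad_E x ^ Suc k) x = 2 * (real k + 1) * d * quad_E x ^ k"
      using lap_mult_quad_E_power[of "\<lambda>x::'a. 1" 0 k] by (simp add: poly_rules euler_homogeneous_def d_def)
    moreover have "lap (\<lambda>x. a * quad_E x ^ Suc k) x = a * lap (\<lambda>x. quad_E x ^ Suc k) x"
      by (subst lap_cmult) (intro poly_rules refl)+
    ultimately show ?thesis using a by simp
  qed
  then have "lap Q = (\<lambda>x. 0)"
    unfolding Q_def by (subst lap_diff[OF poly E]) simp
  moreover have "homogeneous_polynomial g Q"
    unfolding homogeneous_polynomial_def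
  proof (intro conjI allI)
    show "real_polynomial_function Q" unfolding Q_def by (intro poly_rules poly)
    show "Q (t *\<^sub>R x) = t ^ g * Q x" for t x
    proof -
      have "quad_E (t *\<^sub>R x) ^ Suc k = t ^ g * quad_E x ^ Suc k"
        by (simp only: g power_mult power_mult_distrib[symmetric])
          (simp add: quad_E_def power2_eq_square mult.assoc)
      moreover have "P (t *\<^sub>R x) = t ^ g * P x"
        using hom by (simp add: homogeneous_polynomial_def)
      ultimately show ?thesis by (simp add: Q_def right_diff_distrib del: power_Suc)
    qed
  qed
  ultimately show thesis
    using a g by (intro that[of Q a k]) (auto simp: Q_def d_def)
qed

lemma deriv_norm2_1: "deriv_norm2 1 f x = (\<Sum>e\<in>Basis. (dirderiv e f x)\<^sup>2)"
  by (simp add: deriv_norm2_def sum_basis_lists_Suc basis_lists_0)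

text \<open>
  Expand \<open>|dP - a d(E\<^bsup>k+1\<^esup>)|\<^sup>2\<close>. As \<open>d(E\<^bsup>k+1\<^esup>)\<close> is a multiple of \<open>E\<^sup>k x\<close>, the cross term is governed by
  Euler's relation and gives \<open>E\<^sup>k P = E\<^sup>k Q + a E\<^bsup>g-1\<^esup>\<close>.
\<close>

lemma deriv_norm2_harmonic_part:
  fixes P Q :: "'a::euclidean_space \<Rightarrow> real"
  assumes cm: "cartan_muenzner g m1 m2 P"
    and P: "P = (\<lambda>x. Q x + a * quad_E x ^ Suc k)" and a: "a = 0 \<or> g = 2 * Suc k"
  shows "deriv_norm2 1 Q = (\<lambda>x. (real g)\<^sup>2 * ((1 - a\<^sup>2) * quad_E x ^ (g - 1) - 2 * a * (quad_E x ^ k * Q x)))"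
proof
  fix x :: 'a
  have hom: "homogeneous_polynomial g P" using cm by (simp add: cartan_muenzner_def)
  then have poly: "real_polynomial_function P" by (simp add: homogeneous_polynomial_def)
  have gradP: "deriv_norm2 1 P x = (real g)\<^sup>2 * quad_E x ^ (g - 1)"
    using cm by (simp add: cartan_muenzner_def tensor_norm2_iter_deriv)
  show "deriv_norm2 1 Q x = (real g)\<^sup>2 * ((1 - a\<^sup>2) * quad_E x ^ (g - 1) - 2 * a * (quad_E x ^ k * Q x))"
    using a
  proof
    assume "a = 0"
    with gradP P show ?thesis by simp
  next
    assume g: "g = 2 * Suc k"
    \<comment> \<open>The differential of \<open>a E\<^bsup>k+1\<^esup>\<close> is \<open>c\<close> times the radial covector, since \<open>2 (k + 1) = g\<close>.\<close>
    define c where "c = a * real g * quad_E x ^ k"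
    have "Q = (\<lambda>x. P x - a * quad_E x ^ Suc k)" by (simp add: P)
    then have "dirderiv e Q = (\<lambda>x. dirderiv e P x - a * dirderiv e (\<lambda>x. quad_E x ^ Suc k) x)" for e
      using poly by (simp add: dirderiv_diff dirderiv_cmult poly_rules del: power_Suc)
    then have dQ: "dirderiv e Q x = dirderiv e P x - c * (x \<bullet> e)" for e
      by (simp add: dirderiv_quad_E_power c_def g del: power_Suc)
    have E: "(\<Sum>e\<in>Basis. (x \<bullet> e)\<^sup>2) = quad_E x"
      by (simp add: quad_E_def euclidean_inner[of x x] power2_eq_square)
    have Euler: "(\<Sum>e\<in>Basis. (x \<bullet> e) * dirderiv e P x) = real g * P x"
      using homogeneous_polynomial_euler[OF hom] poly by (simp add: euler_homogeneous_def flip: dirderiv_basis)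
    have "deriv_norm2 1 Q x = (\<Sum>e\<in>Basis. (dirderiv e P x)\<^sup>2 - 2 * c * ((x \<bullet> e) * dirderiv e P x)
        + c\<^sup>2 * (x \<bullet> e)\<^sup>2)"
      unfolding deriv_norm2_1 dQ by (intro sum.cong refl) (simp add: power2_eq_square algebra_simps)
    also have "\<dots> = deriv_norm2 1 P x - 2 * c * (real g * P x) + c\<^sup>2 * quad_E x"
      by (simp only: deriv_norm2_1 sum.distrib sum_subtractf sum_distrib_left[symmetric] E Euler)
    also have "\<dots> = (real g)\<^sup>2 * quad_E x ^ (2 * k + 1)
        - 2 * c * (real g * (Q x + a * quad_E x ^ Suc k)) + c\<^sup>2 * quad_E x"
      unfolding gradP by (simp add: P g)
    also have "\<dots> = (real g)\<^sup>2 * ((1 - a\<^sup>2) * quad_E x ^ (2 * k + 1) - 2 * a * (quad_E x ^ k * Q x))"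
      by (simp add: c_def power_mult[of _ k 2] power2_eq_square algebra_simps)
    finally show ?thesis by (simp add: g)
  qed
qed

text \<open>
  Apply \<open>\<Delta>\<close> exactly \<open>j = g - 2\<close> times. The left-hand side becomes a multiple of \<open>|D\<^bsup>g-1\<^esup> Q|\<^sup>2\<close>, the
  first term on the right a multiple of \<open>E\<close>, and \<open>E\<^sup>k Q\<close> disappears as soon as \<open>k < j\<close>. In the
  remaining admissible case \<open>|dQ|\<^sup>2 = -\<beta> Q\<close> is harmonic, so \<open>D\<^sup>2 Q = 0\<close> and the quadratic form
  \<open>Q\<close> vanishes.
\<close>

lemma deriv_norm2_eq_quad_E:
  fixes Q :: "'a::euclidean_space \<Rightarrow> real"
  assumes Q: "homogeneous_polynomial (j + 2) Q" "lap Q = (\<lambda>x. 0)"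
    and grad: "deriv_norm2 1 Q = (\<lambda>x. \<alpha> * quad_E x ^ (j + 1) - \<beta> * (quad_E x ^ k * Q x))"
    and cases: "\<beta> = 0 \<or> k < j \<or> j = 0 \<and> k = 0 \<and> \<alpha> = 0"
  shows "\<exists>b. \<forall>x. deriv_norm2 (j + 1) Q x = b * quad_E x"
proof -
  have poly: "real_polynomial_function Q"
    using Q(1) by (simp add: homogeneous_polynomial_def)
  note eu = homogeneous_polynomial_euler[OF Q(1)]
  have one: "real_polynomial_function (\<lambda>x::'a. 1)" "euler_homogeneous 0 (\<lambda>x::'a. 1)" "lap (\<lambda>x::'a. 1) = (\<lambda>x. 0)"
    by (auto simp: poly_rules euler_homogeneous_def)
  show ?thesis
  proof (cases "\<beta> = 0 \<or> k < j")
    case True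
    obtain C where C: "(lap ^^ j) (\<lambda>x::'a. quad_E x ^ (j + 1)) = (\<lambda>x. C * quad_E x)"
      using lap_funpow_mult_quad_E_power[OF one, of j 1] by auto
    have zero: "\<beta> * (lap ^^ j) (\<lambda>x. quad_E x ^ k * Q x) x = 0" for x
      using True lap_funpow_mult_quad_E_power_zero[OF poly eu Q(2)] by auto
    have "(lap ^^ j) (deriv_norm2 1 Q) x = \<alpha> * C * quad_E x" for x
    proof -
      have "(lap ^^ j) (deriv_norm2 1 Q) x =
          \<alpha> * (lap ^^ j) (\<lambda>x. quad_E x ^ (j + 1)) x - \<beta> * (lap ^^ j) (\<lambda>x. quad_E x ^ k * Q x) x"
        unfolding grad using poly by (simp add: lap_funpow_diff lap_funpow_cmult poly_rules del: power_Suc)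
      then show ?thesis by (simp add: zero C[simplified])
    qed
    then have "2 ^ j * deriv_norm2 (Suc j) Q x = \<alpha> * C * quad_E x" for x
      using lap_funpow_deriv_norm2[OF poly Q(2), of j] by (metis (no_types, lifting))
    then have "deriv_norm2 (j + 1) Q x = \<alpha> * C / 2 ^ j * quad_E x" for x
      by (simp add: field_simps)
    then show ?thesis by blast
  next
    case False
    with cases have z: "j = 0" "k = 0" "\<alpha> = 0" by auto
    have "deriv_norm2 1 Q = (\<lambda>x. (- \<beta>) * Q x)" using grad by (simp add: z)
    then have "lap (deriv_norm2 1 Q) = (\<lambda>x. 0)"
      using poly Q(2) by (simp only: lap_cmult mult_zero_right)
    then have "deriv_norm2 (Suc 1) Q x = 0" for x
      using fun_cong[OF lap_deriv_norm2[OF poly Q(2), of 1], of x] by simp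
    then have zero: "\<forall>es\<in>basis_lists (Suc 1). dirderivs es Q x = 0" for x
      by (simp add: deriv_norm2_def sum_nonneg_eq_0_iff)
    then have D2: "dirderiv e (dirderiv e' Q) x = 0" if "e \<in> Basis" "e' \<in> Basis" for e e' x
    proof -
      have "[e, e'] \<in> basis_lists (Suc 1)" using that by (simp add: basis_lists_def)
      with zero[of x] have "dirderivs [e, e'] Q x = 0" by (rule bspec)
      then show ?thesis by simp
    qed
    have "dirderiv e Q x = 0" if "e \<in> Basis" for e x
    proof -
      have "euler_homogeneous 1 (dirderiv e Q)"
        using euler_dirderiv[OF poly eu, of e] by (simp add: z)
      then have "dirderiv e Q x = (\<Sum>e'\<in>Basis. (x \<bullet> e') * dirderiv e' (dirderiv e Q) x)"
        using poly by (simp add: euler_homogeneous_def poly_rules flip: dirderiv_basis)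
      with D2 that show ?thesis by simp
    qed
    then have "deriv_norm2 (j + 1) Q x = 0 * quad_E x" for x unfolding z add_0 deriv_norm2_1 by simp
    then show ?thesis by blast
  qed
qed

section \<open>Isotropy of the contracted tensor\<close>

lemma linear_tensor_Cons:
  assumes "T \<in> tensors (Suc k)" "length vs = k"
  shows "linear (\<lambda>v. T (v # vs))"
proof -
  have "\<forall>us vs. length us + length vs + 1 = Suc k \<longrightarrow> linear (\<lambda>v. T (us @ v # vs))"
    using assms(1) by (simp add: tensors_def)
  from this[rule_format, of "[]" vs] show ?thesis using assms(2) by simp
qed

text \<open>Polarisation.\<close>

lemma rho_isotropic_iff:
  assumes T: "T \<in> tensors (Suc k)"
  shows "(\<forall>i j. rho (Suc k) T i j = b * (i \<bullet> j)) \<longleftrightarrow> (\<forall>x. rho (Suc k) T x x = b * (x \<bullet> x))"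
proof (intro iffI allI)
  fix i j
  assume diag: "\<forall>x. rho (Suc k) T x x = b * (x \<bullet> x)"
  have add: "T ((i + j) # es) = T (i # es) + T (j # es)" if "es \<in> basis_lists k" for es
    using linear_add[OF linear_tensor_Cons[OF T]] that by (simp add: length_basis_lists)
  have "rho (Suc k) T (i + j) (i + j) =
      rho (Suc k) T i i + 2 * rho (Suc k) T i j + rho (Suc k) T j j"
    by (simp add: rho_def add algebra_simps sum.distrib sum_distrib_left)
  then show "rho (Suc k) T i j = b * (i \<bullet> j)"
    unfolding diag[rule_format] by (simp add: algebra_simps inner_commute)
qed auto

lemma iter_deriv_tensors:
  assumes "real_polynomial_function f"
  shows "iter_deriv k f x \<in> tensors k"
  using linear_dirderivs[OF assms] by (auto simp: tensors_def iter_deriv_eq)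

text \<open>
  The top derivative of \<open>Q\<close> is constant, and inserting \<open>x\<close> into its first slot gives
  \<open>D\<^sup>k Q(x)\<close>, because the components of \<open>D\<^sup>k Q\<close> are linear. So \<open>|D\<^sup>k Q|\<^sup>2\<close> is the quadratic form of
  the tensor \<open>\<rho>\<close>.
\<close>

lemma rho_iter_deriv_diag:
  assumes "homogeneous_polynomial (Suc k) Q"
  shows "rho (Suc k) (iter_deriv (Suc k) Q y) x x = deriv_norm2 k Q x"
proof -
  have poly: "real_polynomial_function Q"
    using assms by (simp add: homogeneous_polynomial_def)
  have "dirderiv x (dirderivs es Q) x = dirderivs es Q x" if "es \<in> basis_lists k" for es
    using euler_dirderivs[OF poly homogeneous_polynomial_euler[OF assms], of es] that
    by (simp add: euler_homogeneous_def length_basis_lists)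
  then have "rho (Suc k) (iter_deriv (Suc k) Q x) x x = deriv_norm2 k Q x"
    by (simp add: rho_def deriv_norm2_def iter_deriv_eq length_basis_lists power2_eq_square)
  then show ?thesis
    by (simp only: iter_deriv_constant[OF assms, of x] iter_deriv_constant[OF assms, of y])
qed

lemma rho_isotropic_iff_deriv_norm2:
  assumes Q: "homogeneous_polynomial (Suc k) Q"
  shows "(\<forall>x i j. rho (Suc k) (iter_deriv (Suc k) Q x) i j = b * (i \<bullet> j)) \<longleftrightarrow>
    (\<forall>x. deriv_norm2 k Q x = b * quad_E x)"
proof -
  have "iter_deriv (Suc k) Q x \<in> tensors (Suc k)" for x
    using Q by (simp add: homogeneous_polynomial_def iter_deriv_tensors)
  from rho_isotropic_iff[OF this] show ?thesis
    by (simp add: rho_iter_deriv_diag[OF Q] quad_E_def)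
qed

text \<open>
  Both sides of the equation are quadratic forms, and a quadratic form is determined by its
  second derivative.
\<close>

lemma deriv_norm2_eq_iff_hessian:
  fixes Q :: "'a::euclidean_space \<Rightarrow> real"
  assumes Q: "homogeneous_polynomial (Suc k) Q"
  shows "(\<forall>x. deriv_norm2 k Q x = b * quad_E x) \<longleftrightarrow>
    (\<forall>x i j. iter_deriv 2 (\<lambda>y. deriv_norm2 k Q y - b * quad_E y) x [i, j] = 0)"
proof
  assume "\<forall>x. deriv_norm2 k Q x = b * quad_E x"
  then show "\<forall>x i j. iter_deriv 2 (\<lambda>y. deriv_norm2 k Q y - b * quad_E y) x [i, j] = 0"
    by (simp add: iter_deriv_eq)
next
  assume hess: "\<forall>x i j. iter_deriv 2 (\<lambda>y. deriv_norm2 k Q y - b * quad_E y) x [i, j] = 0"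
  have poly: "real_polynomial_function Q"
    using Q by (simp add: homogeneous_polynomial_def)
  have scale: "deriv_norm2 k Q (t *\<^sub>R x) = t\<^sup>2 * deriv_norm2 k Q x" for t x
  proof -
    let ?T = "iter_deriv (Suc k) Q 0"
    have "?T ((t *\<^sub>R x) # es) = t * ?T (x # es)" if "es \<in> basis_lists k" for es
      using linear_scale[OF linear_tensor_Cons[OF iter_deriv_tensors[OF poly]]] that
      by (simp add: length_basis_lists)
    then have "rho (Suc k) ?T (t *\<^sub>R x) (t *\<^sub>R x) = t\<^sup>2 * rho (Suc k) ?T x x"
      by (simp add: rho_def sum_distrib_left power2_eq_square mult_ac)
    then show ?thesis by (simp add: rho_iter_deriv_diag[OF Q])
  qed
  have "homogeneous_polynomial 2 (\<lambda>y. deriv_norm2 k Q y - b * quad_E y)"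
    unfolding homogeneous_polynomial_def
  proof (intro conjI allI)
    show "real_polynomial_function (\<lambda>y. deriv_norm2 k Q y - b * quad_E y)"
      by (intro poly_rules poly)
    show "deriv_norm2 k Q (t *\<^sub>R x) - b * quad_E (t *\<^sub>R x) = t\<^sup>2 * (deriv_norm2 k Q x - b * quad_E x)" for t x
      by (simp add: scale quad_E_def power2_eq_square algebra_simps)
  qed
  moreover have "homogeneous_polynomial 2 (\<lambda>y::'a. 0)"
    by (simp add: homogeneous_polynomial_def poly_rules)
  moreover have "iter_deriv 2 (\<lambda>y. deriv_norm2 k Q y - b * quad_E y) = iter_deriv 2 (\<lambda>y. 0)"
  proof (intro ext)
    fix x :: 'a and vs
    show "iter_deriv 2 (\<lambda>y. deriv_norm2 k Q y - b * quad_E y) x vs = iter_deriv 2 (\<lambda>y. 0) x vs"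
    proof (cases "length vs = 2")
      case True
      then obtain i j where "vs = [i, j]" by (auto simp: numeral_2_eq_2 length_Suc_conv)
      with hess show ?thesis by (simp add: iter_deriv_eq)
    qed (simp add: iter_deriv_eq)
  qed
  ultimately have "(\<lambda>y. deriv_norm2 k Q y - b * quad_E y) = (\<lambda>y. 0)"
    by (rule iter_deriv_determines)
  then show "\<forall>x. deriv_norm2 k Q x = b * quad_E x"
    by (simp add: fun_eq_iff)
qed

section \<open>Constant solutions of the coupled Einstein equations in flat space\<close>

lemma cov_deriv_constant: "cov_deriv (\<lambda>x. T) = (\<lambda>x vs. 0)"
  by (auto simp: cov_deriv_def fun_eq_iff split: list.split)

lemma smooth_constant: "smooth_tensor_field (\<lambda>x. T)"
proof -
  have "\<exists>T'. (cov_deriv ^^ m) (\<lambda>x. T) = (\<lambda>x. T')" for m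
    by (induction m) (auto simp: cov_deriv_constant)
  then have "(\<lambda>y. (cov_deriv ^^ m) (\<lambda>x. T) y vs) differentiable (at x)" for m vs x
  proof -
    obtain T' where "(cov_deriv ^^ m) (\<lambda>x. T) = (\<lambda>x. T')"
      using \<open>\<And>m. \<exists>T'. (cov_deriv ^^ m) (\<lambda>x. T) = (\<lambda>x. T')\<close> by blast
    then show ?thesis by simp
  qed
  then show ?thesis
    unfolding smooth_tensor_field_def by blast
qed

lemma ricci_flat: "ricci x u v = 0"
  by (simp add: ricci_def curvature_def conn_def[abs_def] lie_bracket_def)

lemma tensor_norm2_eq_sum_rho:
  "tensor_norm2 (Suc k) T = (\<Sum>e\<in>Basis. rho (Suc k) T e e)"
  by (simp add: tensor_inner_def rho_def sum_basis_lists_Suc)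

text \<open>
  A constant tensor is divergence-free and Codazzi, and the curvature vanishes, so only the
  algebraic equation is left. With \<open>\<rho>(T) = b h\<close>, hence \<open>|T|\<^sup>2 = n b\<close>, its right-hand side
  is \<open>c b (2 - n) / 2\<close> times \<open>h\<close>, which forces \<open>\<kappa> = - n b c\<close> if \<open>n \<noteq> 2\<close>; for \<open>n = 2\<close> both sides vanish.
\<close>

lemma coupled_einstein_constant:
  fixes T :: "'a::euclidean_space tensor"
  assumes "k \<ge> 2" "T \<in> trace_free_tensors k" "\<And>i j. rho k T i j = b * (i \<bullet> j)"
  shows "coupled_einstein k c (- real DIM('a) * b * c) (\<lambda>x. T)"
proof -
  obtain m where k: "k = Suc m" using assms(1) by (cases k) auto
  have "tensor_norm2 k T = real DIM('a) * b"
    using assms(3) by (simp add: k tensor_norm2_eq_sum_rho)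
  then show ?thesis
    using assms
    by (simp add: coupled_einstein_def smooth_constant cov_deriv_constant ricci_flat scal_def
        field_simps)
qed

section \<open>Cartan-Muenzner polynomials and the coupled Einstein equations\<close>

theorem theorem4p16:
  fixes P :: "'a::euclidean_space \<Rightarrow> real"
    and g m1 m2 :: nat
    and \<omega> :: "'a tensor_field"
  assumes "g \<ge> 2"
    and "g = 2 \<longrightarrow> m1 = m2 \<or> \<bar>real m2 - real m1\<bar> = real DIM('a)"
    and "cartan_muenzner g m1 m2 P"
    and "\<omega> = (\<lambda>x. trace_free_part g (iter_deriv g P x))"
  shows
    "(\<exists>b. \<forall>x i j. rho g (\<omega> x) i j = b * (i \<bullet> j)) \<and>
     (\<exists>!Q. homogeneous_polynomial g Q \<and> (\<forall>x. laplacian Q x = 0) \<and> iter_deriv g Q = \<omega>) \<and>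
     (\<forall>Q. homogeneous_polynomial g Q \<and> (\<forall>x. laplacian Q x = 0) \<and> iter_deriv g Q = \<omega> \<longrightarrow>
       (\<forall>b.
         ((\<forall>x i j. rho g (\<omega> x) i j = b * (i \<bullet> j)) \<longleftrightarrow>
          (\<forall>x. tensor_norm2 (g - 1) (iter_deriv (g - 1) Q x) = b * quad_E x)) \<and>
         ((\<forall>x i j. rho g (\<omega> x) i j = b * (i \<bullet> j)) \<longleftrightarrow>
          (\<forall>x i j. iter_deriv 2
             (\<lambda>y. tensor_norm2 (g - 1) (iter_deriv (g - 1) Q y) - b * quad_E y) x [i, j] = 0)))) \<and>
     (\<forall>c. \<exists>\<kappa>. coupled_einstein g c \<kappa> \<omega>)"
proof -
  obtain Q a k where Q: "homogeneous_polynomial g Q" "lap Q = (\<lambda>x. 0)"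
    and P: "P = (\<lambda>x. Q x + a * quad_E x ^ Suc k)"
    and a: "a = 0 \<or>
      g = 2 * Suc k \<and> a * (real DIM('a) + 2 * real k) = (real m2 - real m1) * real (Suc k)"
    by (rule cartan_muenzner_harmonic_part[OF assms(1,3)])
  have poly: "real_polynomial_function Q" using Q by (simp add: homogeneous_polynomial_def)
  obtain j where j: "g = j + 2" using assms(1) by (metis add.commute le_Suc_ex)
  have \<omega>: "iter_deriv g Q = \<omega>"
  proof
    fix x
    have "a = 0 \<or> Suc k < g" using a by auto
    from trace_free_part_iter_deriv[OF poly Q(2) this P] show "iter_deriv g Q x = \<omega> x"
      by (simp add: assms(4))
  qed
  have \<omega>_const: "\<omega> = (\<lambda>x. iter_deriv g Q 0)"
    unfolding \<omega>[symmetric] by (rule ext) (rule iter_deriv_constant[OF Q(1)])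
  have grad: "deriv_norm2 1 Q = (\<lambda>x. (real g)\<^sup>2 * (1 - a\<^sup>2) * quad_E x ^ (j + 1)
      - (real g)\<^sup>2 * (2 * a) * (quad_E x ^ k * Q x))"
    using deriv_norm2_harmonic_part[OF assms(3) P] a by (auto simp: j right_diff_distrib mult.assoc)
  \<comment> \<open>For even \<open>g = 2 (k + 1)\<close> the inequality \<open>k < g - 2 = 2 k\<close> fails only if \<open>k = 0\<close>.\<close>
  have "a = 0 \<or> k < j \<or> j = 0 \<and> k = 0 \<and> a\<^sup>2 = 1"
  proof (cases "a = 0 \<or> k < j")
    case False
    then have "j = 0" "k = 0" using a j by auto
    moreover from this a False have aD: "a * real DIM('a) = real m2 - real m1" by simp
    moreover have "m1 \<noteq> m2" using aD False by auto
    ultimately have "\<bar>a * real DIM('a)\<bar> = real DIM('a)"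
      using assms(2) j by simp
    then have "\<bar>a\<bar> = 1" by (simp add: abs_mult)
    then show ?thesis using \<open>j = 0\<close> \<open>k = 0\<close> by (simp add: abs_square_eq_1)
  qed auto
  then obtain b where b: "\<forall>x. deriv_norm2 (j + 1) Q x = b * quad_E x"
    using deriv_norm2_eq_quad_E[OF Q(1)[unfolded j] Q(2) grad] by auto
  have Sj: "g = Suc (j + 1)" "g - 1 = j + 1" by (simp_all add: j)
  have rho: "\<forall>x i j. rho g (\<omega> x) i j = b * (i \<bullet> j)"
    using rho_isotropic_iff_deriv_norm2[OF Q(1)[unfolded Sj(1)], of b, folded Sj(1)] b
    unfolding \<omega> by (rule iffD2)
  show ?thesis
  proof (intro conjI allI impI)
    show "\<exists>b. \<forall>x i j. rho g (\<omega> x) i j = b * (i \<bullet> j)"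
      using rho by (rule exI)
    show "\<exists>!Q. homogeneous_polynomial g Q \<and> (\<forall>x. laplacian Q x = 0) \<and> iter_deriv g Q = \<omega>"
    proof (rule ex1I[of _ Q])
      show "homogeneous_polynomial g Q \<and> (\<forall>x. laplacian Q x = 0) \<and> iter_deriv g Q = \<omega>"
        using Q \<omega> by (simp add: laplacian_eq)
      fix R assume "homogeneous_polynomial g R \<and> (\<forall>x. laplacian R x = 0) \<and> iter_deriv g R = \<omega>"
      then show "R = Q"
        using Q(1) \<omega> by (intro iter_deriv_determines[of g]) simp_all
    qed
  next
    fix R b
    assume R: "homogeneous_polynomial g R \<and> (\<forall>x. laplacian R x = 0) \<and> iter_deriv g R = \<omega>"
    then have R': "homogeneous_polynomial (Suc (j + 1)) R" by (simp only: Sj(1))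
    have RQ: "iter_deriv (Suc (j + 1)) R = \<omega>" using R by (simp only: Sj(1))
    note isotropic = rho_isotropic_iff_deriv_norm2[OF R', of b, unfolded RQ, folded Sj(1)]
    show "(\<forall>x i j. rho g (\<omega> x) i j = b * (i \<bullet> j)) \<longleftrightarrow>
        (\<forall>x. tensor_norm2 (g - 1) (iter_deriv (g - 1) R x) = b * quad_E x)"
      unfolding tensor_norm2_iter_deriv Sj(2) by (rule isotropic)
    show "(\<forall>x i j. rho g (\<omega> x) i j = b * (i \<bullet> j)) \<longleftrightarrow>
        (\<forall>x i j. iter_deriv 2
           (\<lambda>y. tensor_norm2 (g - 1) (iter_deriv (g - 1) R y) - b * quad_E y) x [i, j] = 0)"
      unfolding tensor_norm2_iter_deriv Sj(2)
      by (rule trans[OF isotropic deriv_norm2_eq_iff_hessian[OF R']])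
  next
    fix c
    have "coupled_einstein g c (- real DIM('a) * b * c) \<omega>"
      unfolding \<omega>_const
    proof (rule coupled_einstein_constant[OF assms(1)])
      show "iter_deriv g Q 0 \<in> trace_free_tensors g" by (rule iter_deriv_trace_free[OF poly Q(2)])
      show "rho g (iter_deriv g Q 0) i j = b * (i \<bullet> j)" for i j
        using rho by (simp add: \<omega>_const)
    qed
    then show "\<exists>\<kappa>. coupled_einstein g c \<kappa> \<omega>" by (rule exI)
  qed
qed

end
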